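(* Let $N\ge1$, and let $\mathcal T_{C^{res}_N}$ be the restricted Clifford twirl on operators of an $N\times N$-mode fermionic system, $$\mathcal T_{C^{res}_N}[\rho]=\frac1{|C^{res}_N|}\sum_{c\in C^{res}_N}(c\wedge c)\rho(c^\dagger\wedge c^\dagger),$$ and let $\mathcal T_{C^{res}_N}^\dagger[\rho]=\frac1{|C^{res}_N|}\sum_{c\in C^{res}_N}(c^\dagger\wedge c^\dagger)\rho(c\wedge c)$. Then: 1. $\mathcal T_{C^{res}_N}=\mathcal T_{C^{res}_N}^\dagger$. 2. $\mathcal T_{C^{res}_N}[\mathbb I_N\wedge\mathbb I_N]=\mathbb I_N\wedge\mathbb I_N$ and $\mathcal T_{C^{res}_N}[\mathbb S_z\wedge\mathbb S_z]=\mathbb S_z\wedge\mathbb S_z$, where $\mathbb S_z=\sigma_z^f\wedge\dots\wedge\sigma_z^f$ ($N$ factors). 3. $\mathcal T_{C^{res}_N}[H_N^{|E\rangle\langle E|}]=H_N^{|E\rangle\langle E|}$ and $\mathcal T_{C^{res}_N}[H_N^{|O\rangle\langle O|}]=H_N^{|O\rangle\langle O|}$. 4. For every $N\times N$-mode fermionic state $\rho^f$, $\mathcal T_{C^{res}_N}[\rho^f]$ is a linear combination of $\mathbb I^{|E\rangle\langle E|}$, $\mathbb I^{|O\rangle\langle O|}$, $H_N^{|E\rangle\langle E|}$ and $H_N^{|O\rangle\langle O|}$.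
   Context: Fermionic setting. An $N$-mode fermionic system has the $d=2^N$ dimensional Fock space with orthonormal occupation-number basis $f_{j_1}^\dagger\cdots f_{j_k}^\dagger|\Omega\rangle$ ($j_1<\dots<j_k$). The basis vectors with $k$ even are denoted $|E_1\rangle,\dots,|E_{d/2}\rangle$ and those with $k$ odd $|O_1\rangle,\dots,|O_{d/2}\rangle$. An operator is block-diagonal (BD) if it lies in the span of the $|E_i\rangle\langle E_j|$, $|O_i\rangle\langle O_j|$, and anti-block-diagonal (ABD) if it lies in the span of the $|E_i\rangle\langle O_j|$, $|O_i\rangle\langle E_j|$. For a composite system $AB$, the vectors $|x\rangle\wedge|y\rangle$ ($x,y$ ranging over the bases of $A$ and $B$; creation operators of $A$ to the left of those of $B$, applied to the vacuum) form an orthonormal basis; $\langle x|\wedge\langle y|$ is the bra dual to $|x\rangle\wedge|y\rangle$; and the wedge product of operators is the bilinear extension of $|x\rangle\langle x'|\wedge|y\rangle\langle y'|=(|x\rangle\wedge|y\rangle)(\langle x'|\wedge\langle y'|)$ (iterated for more factors). A fermionic state is a density operator commuting with total fermion parity (parity superselection rule). $\mathbb I_N$ is the identity on $N$ modes. Pauli and Clifford groups. On one mode, with $|E\rangle=|\Omega\rangle$, $|O\rangle=f^\dagger|\Omega\rangle$: $\sigma_z^f=|E\rangle\langle E|-|O\rangle\langle O|$, $\sigma_x^f=|E\rangle\langle O|+|O\rangle\langle E|$, $\sigma_y^f=-i|E\rangle\langle O|+i|O\rangle\langle E|$. The fermionic Pauli group $P_N$ consists of all $N$-fold wedge products of elements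 of $\{\mathbb I,\sigma_x^f,\sigma_y^f,\sigma_z^f\}$ multiplied by a factor in $\{\pm1,\pm i\}$. The Clifford group $C_N$ is the normalizer of $P_N$ in the unitary group (elements counted modulo global phase). Let $\Xi^{BD}$, $\Xi^{ABD}$ be the sets of BD, respectively ABD, elements of $P_N$. The restricted Clifford set is $$C_N^{res}=\{C\in C_N:\ C\Gamma C^\dagger\in\Xi^{BD}\ \forall\,\Gamma\in\Xi^{BD}\ \text{and}\ C\Gamma C^\dagger\in\Xi^{ABD}\ \forall\,\Gamma\in\Xi^{ABD}\}.$$ Operators on $N\times N$ modes: $\mathbb I^{|E\rangle\langle E|}=\sum_{ij}(|E_i\rangle\langle E_i|\wedge|E_j\rangle\langle E_j|+|O_i\rangle\langle O_i|\wedge|O_j\rangle\langle O_j|)$, $\mathbb I^{|O\rangle\langle O|}=\sum_{ij}(|E_i\rangle\langle E_i|\wedge|O_j\rangle\langle O_j|+|O_i\rangle\langle O_i|\wedge|E_j\rangle\langle E_j|)$, $H_N^{|E\rangle\langle E|}=\sum_{ij}(|E_i\rangle\langle E_j|\wedge|E_j\rangle\langle E_i|+|O_i\rangle\langle O_j|\wedge|O_j\rangle\langle O_i|)$, $H_N^{|O\rangle\langle O|}=\sum_{ij}(|E_i\rangle\langle O_j|\wedge|O_j\rangle\langle E_i|+|O_i\rangle\langle E_j|\wedge|E_j\rangle\langle O_i|)$. *)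

theory Defs
  imports "Jordan_Normal_Form.Schur_Decomposition"
begin

text \<open>
  The Fock space of \<open>N\<close> modes is modelled as \<open>\<complex>\<^sup>d\<close> with \<open>d = 2 ^ N\<close>. The modes are
  \<open>0, \<dots>, N - 1\<close>. A number \<open>x < 2 ^ N\<close> encodes an occupation pattern, mode \<open>0\<close>
  being the most significant bit.
\<close>

definition occ :: "nat \<Rightarrow> nat \<Rightarrow> nat \<Rightarrow> bool" where
  "occ N x j \<longleftrightarrow> j < N \<and> bit x (N - 1 - j)"

definition occupied :: "nat \<Rightarrow> nat \<Rightarrow> nat list" where
  "occupied N x = filter (occ N x) [0..<N]"

definition vacuum :: "nat \<Rightarrow> complex vec" where
  "vacuum N = unit_vec (2 ^ N) 0"

text \<open>The sign is the Jordan-Wigner one, for the mode ordering \<open>0 < 1 < \<dots> < N - 1\<close>.\<close>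

definition creation :: "nat \<Rightarrow> nat \<Rightarrow> complex mat" where
  "creation N j = mat (2 ^ N) (2 ^ N) (\<lambda>(r, c).
     if \<not> occ N c j \<and> r = set_bit (N - 1 - j) c then (- 1) ^ card {i. i < j \<and> occ N c i} else 0)"

definition create_all :: "nat \<Rightarrow> nat list \<Rightarrow> complex vec" where
  "create_all N js = foldr (\<lambda>j v. creation N j *\<^sub>v v) js (vacuum N)"

definition ket :: "nat \<Rightarrow> nat \<Rightarrow> complex vec" where
  "ket N x = create_all N (occupied N x)"

definition even_states :: "nat \<Rightarrow> nat set" where
  "even_states N = {x. x < 2 ^ N \<and> even (length (occupied N x))}"

definition odd_states :: "nat \<Rightarrow> nat set" where
  "odd_states N = {x. x < 2 ^ N \<and> odd (length (occupied N x))}"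

text \<open>
  \<open>wedge_ket N M x y\<close> is \<open>|x\<rangle> \<and> |y\<rangle>\<close>: the modes of the first system are the modes
  \<open>0, \<dots>, N - 1\<close> of the composite system, those of the second one are \<open>N, \<dots>, N + M - 1\<close>.
\<close>

definition wedge_ket :: "nat \<Rightarrow> nat \<Rightarrow> nat \<Rightarrow> nat \<Rightarrow> complex vec" where
  "wedge_ket N M x y = create_all (N + M) (occupied N x @ map ((+) N) (occupied M y))"

definition op_sum :: "nat \<Rightarrow> ('i \<Rightarrow> complex mat) \<Rightarrow> 'i set \<Rightarrow> complex mat" where
  "op_sum d f I = mat d d (\<lambda>(r, c). \<Sum>i\<in>I. f i $$ (r, c))"

definition outer :: "complex vec \<Rightarrow> complex vec \<Rightarrow> complex mat" where
  "outer v w = mat (dim_vec v) (dim_vec w) (\<lambda>(r, c). v $ r * cnj (w $ c))"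

definition ketbra :: "nat \<Rightarrow> nat \<Rightarrow> nat \<Rightarrow> complex mat" where
  "ketbra N x y = outer (ket N x) (ket N y)"

text \<open>
  The wedge product of operators is the bilinear extension of
  \<open>|x\<rangle>\<langle>x'| \<and> |y\<rangle>\<langle>y'| = (|x\<rangle> \<and> |y\<rangle>)(\<langle>x'| \<and> \<langle>y'|)\<close>. Since \<open>ket N x\<close> is the \<open>x\<close>-th
  standard basis vector (lemma \<open>ket_eq_unit_vec\<close>), the coefficient of \<open>|x\<rangle>\<langle>x'|\<close> in \<open>A\<close>
  is the matrix entry at \<open>(x, x')\<close>.
\<close>

definition wedge :: "nat \<Rightarrow> nat \<Rightarrow> complex mat \<Rightarrow> complex mat \<Rightarrow> complex mat" where
  "wedge N M A B = op_sum (2 ^ (N + M))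
     (\<lambda>((x, x'), (y, y')). (A $$ (x, x') * B $$ (y, y')) \<cdot>\<^sub>m outer (wedge_ket N M x y) (wedge_ket N M x' y'))
     (({..<2 ^ N} \<times> {..<2 ^ N}) \<times> ({..<2 ^ M} \<times> {..<2 ^ M}))"

text \<open>The empty product is the scalar \<open>1\<close> on zero modes, which is neutral for \<open>wedge\<close>.\<close>

fun wedge_list :: "complex mat list \<Rightarrow> complex mat" where
  "wedge_list [] = 1\<^sub>m 1"
| "wedge_list (A # As) = wedge 1 (length As) A (wedge_list As)"

definition block_diagonal :: "nat \<Rightarrow> complex mat \<Rightarrow> bool" where
  "block_diagonal N A \<longleftrightarrow> (\<exists>a. A = op_sum (2 ^ N) (\<lambda>(x, y). a x y \<cdot>\<^sub>m ketbra N x y)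
     (even_states N \<times> even_states N \<union> odd_states N \<times> odd_states N))"

definition anti_block_diagonal :: "nat \<Rightarrow> complex mat \<Rightarrow> bool" where
  "anti_block_diagonal N A \<longleftrightarrow> (\<exists>a. A = op_sum (2 ^ N) (\<lambda>(x, y). a x y \<cdot>\<^sub>m ketbra N x y)
     (even_states N \<times> odd_states N \<union> odd_states N \<times> even_states N))"

definition parity_op :: "nat \<Rightarrow> complex mat" where
  "parity_op N = op_sum (2 ^ N) (\<lambda>x. (- 1) ^ length (occupied N x) \<cdot>\<^sub>m ketbra N x x) {..<2 ^ N}"

text \<open>The order on \<open>\<complex>\<close> used for positivity is the partial one: \<open>0 \<le> z\<close> means that \<open>z\<close> is real and nonnegative.\<close>

definition density_operator :: "nat \<Rightarrow> complex mat \<Rightarrow> bool" where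
  "density_operator N \<rho> \<longleftrightarrow> \<rho> \<in> carrier_mat (2 ^ N) (2 ^ N) \<and> mat_adjoint \<rho> = \<rho> \<and>
     (\<forall>v \<in> carrier_vec (2 ^ N). 0 \<le> (\<rho> *\<^sub>v v) \<bullet>c v) \<and> (\<Sum>i<2 ^ N. \<rho> $$ (i, i)) = 1"

definition fermionic_state :: "nat \<Rightarrow> complex mat \<Rightarrow> bool" where
  "fermionic_state N \<rho> \<longleftrightarrow> density_operator N \<rho> \<and> \<rho> * parity_op N = parity_op N * \<rho>"

definition ket_E :: "complex vec" where "ket_E = vacuum 1"
definition ket_O :: "complex vec" where "ket_O = creation 1 0 *\<^sub>v vacuum 1"

definition sigma_z :: "complex mat" where
  "sigma_z = outer ket_E ket_E - outer ket_O ket_O"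

definition sigma_x :: "complex mat" where
  "sigma_x = outer ket_E ket_O + outer ket_O ket_E"

definition sigma_y :: "complex mat" where
  "sigma_y = (- \<i>) \<cdot>\<^sub>m outer ket_E ket_O + \<i> \<cdot>\<^sub>m outer ket_O ket_E"

definition pauli :: "nat \<Rightarrow> complex mat set" where
  "pauli N = {z \<cdot>\<^sub>m wedge_list As | z As. z \<in> {1, - 1, \<i>, - \<i>} \<and> length As = N \<and>
     set As \<subseteq> {1\<^sub>m 2, sigma_x, sigma_y, sigma_z}}"

definition unitary_op :: "nat \<Rightarrow> complex mat \<Rightarrow> bool" where
  "unitary_op N U \<longleftrightarrow> U \<in> carrier_mat (2 ^ N) (2 ^ N) \<and>
     U * mat_adjoint U = 1\<^sub>m (2 ^ N) \<and> mat_adjoint U * U = 1\<^sub>m (2 ^ N)"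

text \<open>
  Unitaries are collected here as matrices; the identification up to a global phase is made in
  \<open>clifford_res_classes\<close>.
\<close>

definition clifford :: "nat \<Rightarrow> complex mat set" where
  "clifford N = {C. unitary_op N C \<and> (\<lambda>\<Gamma>. C * \<Gamma> * mat_adjoint C) ` pauli N = pauli N}"

definition pauli_BD :: "nat \<Rightarrow> complex mat set" where
  "pauli_BD N = {\<Gamma> \<in> pauli N. block_diagonal N \<Gamma>}"

definition pauli_ABD :: "nat \<Rightarrow> complex mat set" where
  "pauli_ABD N = {\<Gamma> \<in> pauli N. anti_block_diagonal N \<Gamma>}"

definition clifford_res :: "nat \<Rightarrow> complex mat set" where
  "clifford_res N = {C \<in> clifford N.
     (\<forall>\<Gamma> \<in> pauli_BD N. C * \<Gamma> * mat_adjoint C \<in> pauli_BD N) \<and>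
     (\<forall>\<Gamma> \<in> pauli_ABD N. C * \<Gamma> * mat_adjoint C \<in> pauli_ABD N)}"

definition phase_rel :: "nat \<Rightarrow> complex mat rel" where
  "phase_rel N = {(C, D). C \<in> clifford_res N \<and> D \<in> clifford_res N \<and> (\<exists>z. cmod z = 1 \<and> D = z \<cdot>\<^sub>m C)}"

definition clifford_res_classes :: "nat \<Rightarrow> complex mat set set" where
  "clifford_res_classes N = clifford_res N // phase_rel N"

text \<open>
  The sums run over classes modulo global phase. The summands do not depend on the chosen
  representatives, see \<open>twirl_representatives\<close>.
\<close>

definition rep :: "complex mat set \<Rightarrow> complex mat" where
  "rep K = (SOME C. C \<in> K)"

definition twirl_term :: "nat \<Rightarrow> complex mat \<Rightarrow> complex mat \<Rightarrow> complex mat" where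
  "twirl_term N X C = wedge N N C C * X * wedge N N (mat_adjoint C) (mat_adjoint C)"

definition twirl_adj_term :: "nat \<Rightarrow> complex mat \<Rightarrow> complex mat \<Rightarrow> complex mat" where
  "twirl_adj_term N X C = wedge N N (mat_adjoint C) (mat_adjoint C) * X * wedge N N C C"

definition twirl :: "nat \<Rightarrow> complex mat \<Rightarrow> complex mat" where
  "twirl N X = (1 / of_nat (card (clifford_res_classes N))) \<cdot>\<^sub>m
     op_sum (2 ^ (N + N)) (\<lambda>K. twirl_term N X (rep K)) (clifford_res_classes N)"

definition twirl_adj :: "nat \<Rightarrow> complex mat \<Rightarrow> complex mat" where
  "twirl_adj N X = (1 / of_nat (card (clifford_res_classes N))) \<cdot>\<^sub>m
     op_sum (2 ^ (N + N)) (\<lambda>K. twirl_adj_term N X (rep K)) (clifford_res_classes N)"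

definition S_z :: "nat \<Rightarrow> complex mat" where
  "S_z N = wedge_list (replicate N sigma_z)"

definition I_EE :: "nat \<Rightarrow> complex mat" where
  "I_EE N = op_sum (2 ^ (N + N)) (\<lambda>(i, j). wedge N N (ketbra N i i) (ketbra N j j))
     (even_states N \<times> even_states N) +
   op_sum (2 ^ (N + N)) (\<lambda>(i, j). wedge N N (ketbra N i i) (ketbra N j j))
     (odd_states N \<times> odd_states N)"

definition I_OO :: "nat \<Rightarrow> complex mat" where
  "I_OO N = op_sum (2 ^ (N + N)) (\<lambda>(i, j). wedge N N (ketbra N i i) (ketbra N j j))
     (even_states N \<times> odd_states N) +
   op_sum (2 ^ (N + N)) (\<lambda>(i, j). wedge N N (ketbra N i i) (ketbra N j j))
     (odd_states N \<times> even_states N)"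

definition H_EE :: "nat \<Rightarrow> complex mat" where
  "H_EE N = op_sum (2 ^ (N + N)) (\<lambda>(i, j). wedge N N (ketbra N i j) (ketbra N j i))
     (even_states N \<times> even_states N) +
   op_sum (2 ^ (N + N)) (\<lambda>(i, j). wedge N N (ketbra N i j) (ketbra N j i))
     (odd_states N \<times> odd_states N)"

definition H_OO :: "nat \<Rightarrow> complex mat" where
  "H_OO N = op_sum (2 ^ (N + N)) (\<lambda>(i, j). wedge N N (ketbra N i j) (ketbra N j i))
     (even_states N \<times> odd_states N) +
   op_sum (2 ^ (N + N)) (\<lambda>(i, j). wedge N N (ketbra N i j) (ketbra N j i))
     (odd_states N \<times> even_states N)"

lemma bit_foldr_set_bit:
  "bit (foldr (\<lambda>j y. set_bit (f j) y) js (0 :: nat)) k \<longleftrightarrow> k \<in> f ` set js"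
  by (induction js) (auto simp: bit_set_bit_iff)

lemma nat_less_exp_if_bits:
  fixes y :: nat
  assumes "\<And>k. bit y k \<Longrightarrow> k < N"
  shows "y < 2 ^ N"
proof -
  have "take_bit N y = y"
    using assms by (auto intro!: bit_eqI simp: bit_take_bit_iff)
  then show ?thesis by (metis take_bit_nat_less_exp)
qed

lemma create_all_sorted:
  assumes "sorted_wrt (<) js" "set js \<subseteq> {..<N}"
  shows "create_all N js = unit_vec (2 ^ N) (foldr (\<lambda>j y. set_bit (N - 1 - j) y) js 0)"
  using assms
proof (induction js)
  case Nil
  then show ?case by (simp add: create_all_def vacuum_def)
next
  case (Cons j js)
  define f where "f = (\<lambda>j. N - 1 - j)"
  define c where "c = foldr (\<lambda>j y. set_bit (f j) y) js (0 :: nat)"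
  have bit_c: "bit c k \<longleftrightarrow> k \<in> f ` set js" for k
    unfolding c_def by (rule bit_foldr_set_bit)
  have jN: "j < N" and js: "\<And>i. i \<in> set js \<Longrightarrow> j < i \<and> i < N" using Cons.prems by auto
  have occ_c: "occ N c i \<longleftrightarrow> i \<in> set js" for i
  proof
    assume "occ N c i"
    then obtain k where k: "k \<in> set js" "N - 1 - i = N - 1 - k" "i < N"
      by (auto simp: occ_def bit_c f_def)
    moreover have "k < N" using js k by auto
    ultimately have "i = k" by arith
    with k show "i \<in> set js" by simp
  next
    assume "i \<in> set js"
    with js show "occ N c i" by (auto simp: occ_def bit_c f_def)
  qed
  have cN: "c < 2 ^ N"
    by (rule nat_less_exp_if_bits) (use js in \<open>fastforce simp: bit_c f_def\<close>)
  have rN: "set_bit (f j) c < 2 ^ N"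
    by (rule nat_less_exp_if_bits) (use js jN in \<open>fastforce simp: bit_set_bit_iff bit_c f_def\<close>)
  have no_lower: "{i. i < j \<and> occ N c i} = {}" using js by (fastforce simp: occ_c)
  have "\<not> occ N c j" using js by (auto simp: occ_c)
  then have "creation N j *\<^sub>v unit_vec (2 ^ N) c = unit_vec (2 ^ N) (set_bit (f j) c)"
    using cN rN by (intro eq_vecI) (auto simp: no_lower creation_def f_def unit_vec_def
        scalar_prod_def if_distrib[of "(*) _"] cong: if_cong)
  moreover have "create_all N js = unit_vec (2 ^ N) c"
    using Cons by (simp add: c_def f_def)
  ultimately show ?case by (simp add: create_all_def c_def f_def)
qed

lemma ket_eq_unit_vec:
  assumes "x < 2 ^ N"
  shows "ket N x = unit_vec (2 ^ N) x"
proof -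
  have hi: "k < N" if "bit x k" for k
    using that assms by (metis bit_take_bit_iff take_bit_nat_eq_self)
  have "foldr (\<lambda>j y. set_bit (N - 1 - j) y) (occupied N x) 0 = x"
  proof (rule bit_eqI)
    fix k
    have "k \<in> (\<lambda>j. N - 1 - j) ` set (occupied N x) \<longleftrightarrow> bit x k"
    proof
      assume "bit x k"
      with hi[of k] show "k \<in> (\<lambda>j. N - 1 - j) ` set (occupied N x)"
        by (intro image_eqI[of _ _ "N - 1 - k"]) (auto simp: occupied_def occ_def)
    qed (auto simp: occupied_def occ_def)
    then show "bit (foldr (\<lambda>j y. set_bit (N - 1 - j) y) (occupied N x) (0 :: nat)) k = bit x k"
      by (simp only: bit_foldr_set_bit)
  qed
  moreover have "sorted_wrt (<) (occupied N x)" "set (occupied N x) \<subseteq> {..<N}"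
    by (auto simp: occupied_def sorted_wrt_filter)
  ultimately show ?thesis by (simp add: ket_def create_all_sorted)
qed

lemma occupied_wedge:
  assumes "y < 2 ^ M"
  shows "occupied (N + M) (x * 2 ^ M + y) = occupied N x @ map ((+) N) (occupied M y)"
proof -
  have 1: "bit (x * 2 ^ M + y) (M + k) = bit x k" for k
    using assms by (simp add: bit_iff_odd power_add div_mult2_eq)
  have 2: "bit (x * 2 ^ M + y) k = bit y k" if "k < M" for k
  proof -
    have "bit (x * 2 ^ M + y) k = bit (take_bit M (x * 2 ^ M + y)) k"
      using that by (simp add: bit_take_bit_iff)
    also have "take_bit M (x * 2 ^ M + y) = y" using assms by (simp add: take_bit_eq_mod)
    finally show ?thesis .
  qed
  have "filter (occ (N + M) (x * 2 ^ M + y)) [0..<N] = filter (occ N x) [0..<N]"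
  proof (rule filter_cong[OF refl])
    fix j assume "j \<in> set [0..<N]"
    then have j: "j < N" and eq: "N + M - 1 - j = M + (N - 1 - j)" by auto
    from j show "occ (N + M) (x * 2 ^ M + y) j = occ N x j"
      unfolding occ_def eq 1 by simp
  qed
  moreover have "filter (occ (N + M) (x * 2 ^ M + y)) (map ((+) N) [0..<M]) =
      map ((+) N) (filter (occ M y) [0..<M])"
    unfolding filter_map
    by (intro arg_cong[where f = "map _"] filter_cong) (auto simp: occ_def 2)
  moreover have "[0..<N + M] = [0..<N] @ map ((+) N) [0..<M]"
  proof -
    have "map ((+) N) [0..<M] = [N..<N + M]"
      by (rule nth_equalityI) simp_all
    then show ?thesis by (simp add: upt_add_eq_append[of 0 N M])
  qed
  ultimately show ?thesis by (simp add: occupied_def)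
qed

lemma wedge_index_less:
  fixes x y :: nat
  assumes "x < 2 ^ N" "y < 2 ^ M"
  shows "x * 2 ^ M + y < 2 ^ (N + M)"
proof -
  have "x * 2 ^ M + y < (x + 1) * 2 ^ M" using assms by simp
  also have "\<dots> \<le> 2 ^ N * 2 ^ M" using assms by (intro mult_right_mono) auto
  finally show ?thesis by (simp add: power_add)
qed

lemma wedge_ket_eq_unit_vec:
  assumes "x < 2 ^ N" "y < 2 ^ M"
  shows "wedge_ket N M x y = unit_vec (2 ^ (N + M)) (x * 2 ^ M + y)"
  using ket_eq_unit_vec[OF wedge_index_less[OF assms]] assms
  by (simp add: wedge_ket_def ket_def occupied_wedge)

lemma wedge_carrier [simp]: "wedge N M A B \<in> carrier_mat (2 ^ (N + M)) (2 ^ (N + M))"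
  by (simp add: wedge_def op_sum_def)

lemma wedge_index:
  assumes r: "r < 2 ^ (N + M)" and c: "c < 2 ^ (N + M)"
  shows "wedge N M A B $$ (r, c) =
    A $$ (r div 2 ^ M, c div 2 ^ M) * B $$ (r mod 2 ^ M, c mod 2 ^ M)"
proof -
  let ?X = "({..<2 ^ N} \<times> {..<2 ^ N}) \<times> ({..<2 ^ M} \<times> {..<2 ^ M}) :: ((nat \<times> nat) \<times> nat \<times> nat) set"
  let ?p = "((r div 2 ^ M, c div 2 ^ M), (r mod 2 ^ M, c mod 2 ^ M))"
  let ?f = "\<lambda>((x, x'), (y, y')). A $$ (x, x') * B $$ (y, y')"
  have dec: "r = x * 2 ^ M + y \<longleftrightarrow> x = r div 2 ^ M \<and> y = r mod 2 ^ M"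
    if "y < 2 ^ M" for r x y :: nat using that by (auto simp: div_mult_mod_eq)
  have summand: "((A $$ (x, x') * B $$ (y, y')) \<cdot>\<^sub>m outer (wedge_ket N M x y) (wedge_ket N M x' y')) $$ (r, c) =
      (if ((x, x'), (y, y')) = ?p then A $$ (x, x') * B $$ (y, y') else 0)"
    if "x < 2 ^ N" "x' < 2 ^ N" "y < 2 ^ M" "y' < 2 ^ M" for x x' y y'
    using that r c by (auto simp: outer_def wedge_ket_eq_unit_vec unit_vec_def dec)
  have "wedge N M A B $$ (r, c) = (\<Sum>p\<in>?X. if p = ?p then ?f p else 0)"
    unfolding wedge_def op_sum_def index_mat(1)[OF r c] prod.case
    by (intro sum.cong[OF refl]) (auto simp del: index_smult_mat simp add: summand split del: if_split)
  also have "\<dots> = ?f ?p"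
    using r c by (subst sum.delta) (auto simp: power_add less_mult_imp_div_less)
  finally show ?thesis by simp
qed

lemma mat_adjoint_index:
  assumes "A \<in> carrier_mat n n" "i < n" "j < n"
  shows "mat_adjoint A $$ (i, j) = cnj (A $$ (j, i))"
  using assms by (auto simp: mat_adjoint_def mat_of_rows_def)

lemma mat_adjoint_carrier:
  assumes "A \<in> carrier_mat n n"
  shows "mat_adjoint A \<in> carrier_mat n n"
  using assms by (auto simp: mat_adjoint_def)

lemma mat_adjoint_smult:
  assumes "A \<in> carrier_mat n n"
  shows "mat_adjoint (z \<cdot>\<^sub>m A) = cnj z \<cdot>\<^sub>m mat_adjoint A"
  by (rule eq_matI)
    (use assms in \<open>auto simp: mat_adjoint_def mat_of_rows_def\<close>)

lemma wedge_smult: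
  assumes "A \<in> carrier_mat (2 ^ N) (2 ^ N)" "B \<in> carrier_mat (2 ^ M) (2 ^ M)"
  shows "wedge N M (y \<cdot>\<^sub>m A) (z \<cdot>\<^sub>m B) = (y * z) \<cdot>\<^sub>m wedge N M A B"
proof (rule eq_matI)
  fix i j assume "i < dim_row ((y * z) \<cdot>\<^sub>m wedge N M A B)" "j < dim_col ((y * z) \<cdot>\<^sub>m wedge N M A B)"
  then have ij: "i < 2 ^ (N + M)" "j < 2 ^ (N + M)"
    using wedge_carrier[of N M A B] by auto
  then have "i div 2 ^ M < 2 ^ N" "j div 2 ^ M < 2 ^ N"
    by (auto simp: power_add less_mult_imp_div_less)
  with ij assms show "wedge N M (y \<cdot>\<^sub>m A) (z \<cdot>\<^sub>m B) $$ (i, j) = ((y * z) \<cdot>\<^sub>m wedge N M A B) $$ (i, j)"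
    by (simp add: wedge_index carrier_matD[OF wedge_carrier])
qed (simp_all add: carrier_matD[OF wedge_carrier])

lemma twirl_term_phase:
  assumes C: "C \<in> carrier_mat (2 ^ N) (2 ^ N)" and X: "X \<in> carrier_mat (2 ^ (N + N)) (2 ^ (N + N))"
    and z: "cmod z = 1"
  shows "twirl_term N X (z \<cdot>\<^sub>m C) = twirl_term N X C"
    and "twirl_adj_term N X (z \<cdot>\<^sub>m C) = twirl_adj_term N X C"
proof -
  let ?W = "wedge N N C C" and ?V = "wedge N N (mat_adjoint C) (mat_adjoint C)"
  have zz: "z * cnj z = 1" using z by (simp add: complex_norm_square[symmetric])
  have "z * z * (cnj z * cnj z) = (z * cnj z) * (z * cnj z)" by (simp only: mult_ac)
  then have u1: "z * z * (cnj z * cnj z) = 1" by (simp only: zz mult_1)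
  have u2: "cnj z * cnj z * (z * z) = 1" by (rule trans[OF mult.commute u1])
  have scal: "(a \<cdot>\<^sub>m P) * X * (b \<cdot>\<^sub>m Q) = P * X * Q"
    if "a * b = 1" "P \<in> carrier_mat (2 ^ (N + N)) (2 ^ (N + N))"
      "Q \<in> carrier_mat (2 ^ (N + N)) (2 ^ (N + N))" for a b P Q
  proof -
    have ba: "b * (a * x) = x" for x
      using that(1) by (metis mult.assoc mult.commute mult_1)
    have "(a \<cdot>\<^sub>m P) * X * (b \<cdot>\<^sub>m Q) = b \<cdot>\<^sub>m (a \<cdot>\<^sub>m (P * X) * Q)"
      using that X by (simp add: mult_smult_distrib[of _ "2 ^ (N + N)" "2 ^ (N + N)" _ "2 ^ (N + N)"]
          mult_smult_assoc_mat[of _ "2 ^ (N + N)" "2 ^ (N + N)" _ "2 ^ (N + N)"])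
    also have "a \<cdot>\<^sub>m (P * X) * Q = a \<cdot>\<^sub>m (P * X * Q)"
      using that X by (intro mult_smult_assoc_mat[of _ "2 ^ (N + N)" "2 ^ (N + N)"]) auto
    also have "b \<cdot>\<^sub>m (a \<cdot>\<^sub>m (P * X * Q)) = P * X * Q"
      by (rule eq_matI) (simp_all add: ba)
    finally show ?thesis .
  qed
  note C' = mat_adjoint_carrier[OF C]
  show "twirl_term N X (z \<cdot>\<^sub>m C) = twirl_term N X C"
    "twirl_adj_term N X (z \<cdot>\<^sub>m C) = twirl_adj_term N X C"
    using u1 u2 scal by (simp_all add: twirl_term_def twirl_adj_term_def mat_adjoint_smult[OF C]
        wedge_smult[OF C C] wedge_smult[OF C' C'])
qed

lemma twirl_representatives:
  assumes r: "\<And>K. K \<in> clifford_res_classes N \<Longrightarrow> r K \<in> K"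
    and X: "X \<in> carrier_mat (2 ^ (N + N)) (2 ^ (N + N))"
  shows "twirl N X = (1 / of_nat (card (clifford_res_classes N))) \<cdot>\<^sub>m
      op_sum (2 ^ (N + N)) (\<lambda>K. twirl_term N X (r K)) (clifford_res_classes N)"
    and "twirl_adj N X = (1 / of_nat (card (clifford_res_classes N))) \<cdot>\<^sub>m
      op_sum (2 ^ (N + N)) (\<lambda>K. twirl_adj_term N X (r K)) (clifford_res_classes N)"
proof -
  have eq: "twirl_term N X (rep K) = twirl_term N X (r K) \<and>
      twirl_adj_term N X (rep K) = twirl_adj_term N X (r K)"
    if K: "K \<in> clifford_res_classes N" for K
  proof -
    obtain C where C: "C \<in> clifford_res N" and KC: "K = phase_rel N `` {C}"
      using K by (auto simp: clifford_res_classes_def elim: quotientE)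
    have carr: "C \<in> carrier_mat (2 ^ N) (2 ^ N)"
      using C by (simp add: clifford_res_def clifford_def unitary_op_def)
    have "rep K \<in> K" unfolding rep_def by (rule someI) (rule r[OF K])
    with r[OF K] obtain y z where "cmod y = 1" "cmod z = 1" "rep K = y \<cdot>\<^sub>m C" "r K = z \<cdot>\<^sub>m C"
      unfolding KC by (auto simp: phase_rel_def)
    then show ?thesis using twirl_term_phase[OF carr X] by simp
  qed
  show "twirl N X = (1 / of_nat (card (clifford_res_classes N))) \<cdot>\<^sub>m
      op_sum (2 ^ (N + N)) (\<lambda>K. twirl_term N X (r K)) (clifford_res_classes N)"
    and "twirl_adj N X = (1 / of_nat (card (clifford_res_classes N))) \<cdot>\<^sub>m
      op_sum (2 ^ (N + N)) (\<lambda>K. twirl_adj_term N X (r K)) (clifford_res_classes N)"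
    using eq by (simp_all add: twirl_def twirl_adj_def op_sum_def)
qed

end

theory Submission
  imports Defs
begin

text \<open>
  Expand an operator on \<open>N + N\<close> modes in products \<open>A \<and> B\<close> of Pauli strings. The coefficients of a
  twirled operator are invariant under \<open>(A, B) \<mapsto> (C A C\<^sup>\<dagger>, C B C\<^sup>\<dagger>)\<close> for restricted Clifford \<open>C\<close>. If
  \<open>A \<noteq> B\<close>, some Pauli operator commutes with exactly one of \<open>A\<close> and \<open>B\<close>, so the coefficient vanishes.
  The diagonal coefficients are constant on the orbits \<open>{\<one>}\<close>, \<open>{S_z}\<close>, the other
  block-diagonal strings and the anti-block-diagonal strings. Transitivity on the last two classes
  rests on the unitary \<open>(A + B) / sqrt 2\<close>, which exchanges anticommuting hermitian Pauli operators
  \<open>A\<close> and \<open>B\<close>, and which is restricted Clifford if \<open>A\<close> and \<open>B\<close> have the same block type. Finally,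
  the sum of \<open>A \<and> A\<close> over all strings is \<open>2 ^ N\<close> times the swap operator, and its block-diagonal and
  anti-block-diagonal parts are \<open>2 ^ N\<close> times \<open>H_EE\<close> and \<open>H_OO\<close>.

  Since \<open>C S_z C\<^sup>\<dagger> = \<plusminus> S_z\<close> for restricted Clifford \<open>C\<close>, all \<open>C \<and> C\<close> commute with \<open>S_z \<and> S_z\<close>, and as
  they commute with the swap they fix \<open>H_EE\<close> and \<open>H_OO\<close>; the adjoint twirl is the twirl
  reindexed by \<open>C \<mapsto> C\<^sup>\<dagger>\<close>.
\<close>

section \<open>Square complex matrices, their adjoint and trace\<close>

abbreviation (input) sq :: "nat \<Rightarrow> complex mat set" where
  "sq n \<equiv> carrier_mat n n"

lemma sq_mult [simp]: "A \<in> sq n \<Longrightarrow> B \<in> sq n \<Longrightarrow> A * B \<in> sq n"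
  by (rule mult_carrier_mat)

lemma sq_assoc: "A \<in> sq n \<Longrightarrow> B \<in> sq n \<Longrightarrow> C \<in> sq n \<Longrightarrow> A * B * C = A * (B * C)"
  by (rule assoc_mult_mat)

lemma sq_smult_left: "A \<in> sq n \<Longrightarrow> B \<in> sq n \<Longrightarrow> (z \<cdot>\<^sub>m A) * B = z \<cdot>\<^sub>m (A * B)"
  by (rule mult_smult_assoc_mat)

lemma sq_smult_right: "A \<in> sq n \<Longrightarrow> B \<in> sq n \<Longrightarrow> A * (z \<cdot>\<^sub>m B) = z \<cdot>\<^sub>m (A * B)"
  by (rule mult_smult_distrib)

lemma smult_smult_mat [simp]: "a \<cdot>\<^sub>m (b \<cdot>\<^sub>m A) = (a * b) \<cdot>\<^sub>m (A :: complex mat)"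
  by (rule eq_matI) auto

lemma one_smult_mat [simp]: "1 \<cdot>\<^sub>m A = (A :: complex mat)"
  by (rule eq_matI) auto

lemmas sq_simps = sq_assoc sq_smult_left sq_smult_right

lemma sq_mult_index:
  assumes "A \<in> sq n" "B \<in> sq n" "i < n" "j < n"
  shows "(A * B) $$ (i, j) = (\<Sum>k<n. A $$ (i, k) * B $$ (k, j))"
  using assms by (simp add: scalar_prod_def atLeast0LessThan)

lemma sq_eqI:
  assumes "A \<in> sq n" "B \<in> sq n" "\<And>i j. i < n \<Longrightarrow> j < n \<Longrightarrow> A $$ (i, j) = B $$ (i, j)"
  shows "A = B"
  using assms by (intro eq_matI) auto

lemmas adj_sq [simp] = mat_adjoint_carrier

lemma adj_adj [simp]: "A \<in> sq n \<Longrightarrow> mat_adjoint (mat_adjoint A) = A"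
  by (rule sq_eqI[of _ n]) (auto simp: mat_adjoint_index[of _ n])

lemma adj_one [simp]: "mat_adjoint (1\<^sub>m n) = (1\<^sub>m n :: complex mat)"
  by (rule sq_eqI[of _ n]) (auto simp: mat_adjoint_index[of _ n])

lemma adj_add: "A \<in> sq n \<Longrightarrow> B \<in> sq n \<Longrightarrow> mat_adjoint (A + B) = mat_adjoint A + mat_adjoint B"
  using carrier_matD[OF adj_sq[of A n]] carrier_matD[OF adj_sq[of B n]]
  by (intro sq_eqI[of _ n]) (auto simp: mat_adjoint_index[of _ n])

lemma adj_mult: "A \<in> sq n \<Longrightarrow> B \<in> sq n \<Longrightarrow> mat_adjoint (A * B) = mat_adjoint B * mat_adjoint A"
  by (rule sq_eqI[of _ n])
    (auto simp: mat_adjoint_index[of _ n] sq_mult_index[of _ n] mult.commute simp del: index_mult_mat)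

definition tr :: "complex mat \<Rightarrow> complex" where
  "tr A = (\<Sum>i<dim_row A. A $$ (i, i))"

lemma tr_mult:
  assumes "A \<in> sq n" "B \<in> sq n"
  shows "tr (A * B) = (\<Sum>i<n. \<Sum>j<n. A $$ (i, j) * B $$ (j, i))"
  using assms by (simp add: tr_def sq_mult_index[of _ n] del: index_mult_mat(1))

lemma tr_mult_commute: "A \<in> sq n \<Longrightarrow> B \<in> sq n \<Longrightarrow> tr (A * B) = tr (B * A)"
  by (simp add: tr_mult[of _ n]) (subst sum.swap, simp add: mult.commute)

lemma tr_smult: "tr (z \<cdot>\<^sub>m A) = z * tr A" if "A \<in> sq n"
  using that by (simp add: tr_def sum_distrib_left)

subsection \<open>The wedge product\<close>

lemma div_mod_less:
  fixes r :: nat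
  assumes "r < 2 ^ (N + M)"
  shows "r div 2 ^ M < 2 ^ N" "r mod 2 ^ M < 2 ^ M"
  using assms by (auto simp: power_add less_mult_imp_div_less)

text \<open>A composite index \<open>k\<close> stands for the pair
  \<open>(k div 2 ^ M, k mod 2 ^ M)\<close>; the bijection is this decoding together with its
  inverse.\<close>

lemma sum_div_mod:
  fixes f :: "nat \<Rightarrow> nat \<Rightarrow> 'a :: comm_monoid_add"
  shows "(\<Sum>k<2 ^ (N + M). f (k div 2 ^ M) (k mod 2 ^ M)) = (\<Sum>x<2 ^ N. \<Sum>y<2 ^ M. f x y)"
  unfolding sum.cartesian_product
  by (rule sum.reindex_bij_witness[of _ "\<lambda>(x, y). x * 2 ^ M + y" "\<lambda>k. (k div 2 ^ M, k mod 2 ^ M)"])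
    (auto simp: div_mod_less div_mult_mod_eq intro: wedge_index_less)

text \<open>No fermionic sign appears: the wedge of operators is built from ket-bras in a fixed
  creation order, so by \<open>wedge_index\<close> its entries are those of a Kronecker product, and
  the sum over the intermediate composite index factorizes.\<close>

lemma wedge_mult:
  assumes "A \<in> sq (2 ^ N)" "C \<in> sq (2 ^ N)" "B \<in> sq (2 ^ M)" "D \<in> sq (2 ^ M)"
  shows "wedge N M A B * wedge N M C D = wedge N M (A * C) (B * D)"
proof (rule sq_eqI[of _ "2 ^ (N + M)"])
  fix i j assume ij: "i < (2 :: nat) ^ (N + M)" "j < (2 :: nat) ^ (N + M)"
  let ?a = "\<lambda>k. A $$ (i div 2 ^ M, k) * C $$ (k, j div 2 ^ M)"
  let ?b = "\<lambda>k. B $$ (i mod 2 ^ M, k) * D $$ (k, j mod 2 ^ M)"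
  have "(wedge N M A B * wedge N M C D) $$ (i, j) =
      (\<Sum>k<2 ^ (N + M). wedge N M A B $$ (i, k) * wedge N M C D $$ (k, j))"
    by (rule sq_mult_index) (use ij in simp_all)
  also have "\<dots> = (\<Sum>k<2 ^ (N + M). ?a (k div 2 ^ M) * ?b (k mod 2 ^ M))"
    using ij by (intro sum.cong) (simp_all add: wedge_index mult_ac)
  also have "\<dots> = (\<Sum>x<2 ^ N. ?a x) * (\<Sum>y<2 ^ M. ?b y)"
    by (simp add: sum_div_mod[of "\<lambda>x y. ?a x * ?b y"] sum_product)
  also have "\<dots> = wedge N M (A * C) (B * D) $$ (i, j)"
    using ij div_mod_less[OF ij(1)] div_mod_less[OF ij(2)] assms
    by (simp add: wedge_index sq_mult_index[of _ "2 ^ N"] sq_mult_index[of _ "2 ^ M"]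
        del: index_mult_mat(1))
  finally show "(wedge N M A B * wedge N M C D) $$ (i, j) = wedge N M (A * C) (B * D) $$ (i, j)" .
qed simp_all

lemma wedge_one: "wedge N M (1\<^sub>m (2 ^ N)) (1\<^sub>m (2 ^ M)) = 1\<^sub>m (2 ^ (N + M))"
proof (rule sq_eqI[of _ "2 ^ (N + M)"])
  fix i j assume ij: "i < (2 :: nat) ^ (N + M)" "j < (2 :: nat) ^ (N + M)"
  have "i = j \<longleftrightarrow> i div 2 ^ M = j div 2 ^ M \<and> i mod 2 ^ M = j mod 2 ^ M"
    by (metis div_mult_mod_eq)
  then show "wedge N M (1\<^sub>m (2 ^ N)) (1\<^sub>m (2 ^ M)) $$ (i, j) = 1\<^sub>m (2 ^ (N + M)) $$ (i, j)"
    using ij by (simp add: wedge_index div_mod_less)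
qed simp_all

lemma wedge_adj:
  assumes "A \<in> sq (2 ^ N)" "B \<in> sq (2 ^ M)"
  shows "mat_adjoint (wedge N M A B) = wedge N M (mat_adjoint A) (mat_adjoint B)"
  by (rule sq_eqI[of _ "2 ^ (N + M)"])
    (use assms in \<open>simp_all add: mat_adjoint_index[of _ "2 ^ (N + M)"] wedge_index
      mat_adjoint_index[of _ "2 ^ N"] mat_adjoint_index[of _ "2 ^ M"] div_mod_less\<close>)

subsection \<open>Pauli strings\<close>

lemma ket_E_unit: "ket_E = unit_vec 2 0"
  by (simp add: ket_E_def vacuum_def)

lemma ket_O_unit: "ket_O = unit_vec 2 1"
  using ket_eq_unit_vec[of 1 1]
  by (simp add: ket_O_def ket_def create_all_def occupied_def occ_def bit_Suc_0_iff)

lemma sigma_mat: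
  "sigma_x = mat 2 2 (\<lambda>(i, j). if i = j then 0 else 1)"
  "sigma_y = mat 2 2 (\<lambda>(i, j). if i = j then 0 else if i = 0 then - \<i> else \<i>)"
  "sigma_z = mat 2 2 (\<lambda>(i, j). if i = j then if i = 0 then 1 else - 1 else 0)"
  by (rule eq_matI; auto simp: sigma_x_def sigma_y_def sigma_z_def outer_def ket_E_unit ket_O_unit
      less_2_cases_iff)+

definition pauli1 :: "complex mat set" where
  "pauli1 = {1\<^sub>m 2, sigma_x, sigma_y, sigma_z}"

definition phases :: "complex set" where
  "phases = {1, - 1, \<i>, - \<i>}"

lemma phases_mult [simp]: "y \<in> phases \<Longrightarrow> z \<in> phases \<Longrightarrow> y * z \<in> phases"
  by (auto simp: phases_def)

lemma phases_cnj [simp]: "z \<in> phases \<Longrightarrow> cnj z \<in> phases"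
  by (auto simp: phases_def)

lemma phases_unit: "z \<in> phases \<Longrightarrow> z * cnj z = 1"
  by (auto simp: phases_def)

lemma phases_simps [simp]: "1 \<in> phases" "- 1 \<in> phases" "\<i> \<in> phases" "- \<i> \<in> phases"
  by (auto simp: phases_def)

lemma mat2_eqI:
  assumes "A \<in> sq 2" "B \<in> sq 2" "A $$ (0, 0) = B $$ (0, 0)" "A $$ (0, 1) = B $$ (0, 1)"
    "A $$ (1, 0) = B $$ (1, 0)" "A $$ (1, 1) = B $$ (1, 1)"
  shows "A = B"
  using assms by (intro sq_eqI[of _ 2]) (auto simp: less_2_cases_iff)

lemma sum_2: "(\<Sum>i<2 :: nat. f i) = f 0 + (f 1 :: complex)"
  by (simp add: numeral_2_eq_2)

lemma mat2_mult_index: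
  assumes "A \<in> sq 2" "B \<in> sq 2" "i < 2" "j < 2"
  shows "(A * B) $$ (i, j) = A $$ (i, 0) * B $$ (0, j) + A $$ (i, 1) * B $$ (1, j)"
  using assms by (simp add: sq_mult_index[of _ 2] sum_2 del: index_mult_mat(1))

lemma pauli1_sq [simp]: "A \<in> pauli1 \<Longrightarrow> A \<in> sq 2"
  by (auto simp: pauli1_def sigma_mat)

lemma sigma_sq [simp]: "sigma_x \<in> sq 2" "sigma_y \<in> sq 2" "sigma_z \<in> sq 2"
  by (auto simp: sigma_mat)

lemma sigma_index:
  "i < 2 \<Longrightarrow> j < 2 \<Longrightarrow> sigma_x $$ (i, j) = (if i = j then 0 else 1)"
  "i < 2 \<Longrightarrow> j < 2 \<Longrightarrow> sigma_y $$ (i, j) = (if i = j then 0 else if i = 0 then - \<i> else \<i>)"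
  "i < 2 \<Longrightarrow> j < 2 \<Longrightarrow> sigma_z $$ (i, j) = (if i = j then if i = 0 then 1 else - 1 else 0)"
  by (auto simp: sigma_mat)

lemma sigma_mult:
  "sigma_x * sigma_x = 1\<^sub>m 2" "sigma_y * sigma_y = 1\<^sub>m 2" "sigma_z * sigma_z = 1\<^sub>m 2"
  "sigma_x * sigma_y = \<i> \<cdot>\<^sub>m sigma_z" "sigma_y * sigma_x = (- \<i>) \<cdot>\<^sub>m sigma_z"
  "sigma_y * sigma_z = \<i> \<cdot>\<^sub>m sigma_x" "sigma_z * sigma_y = (- \<i>) \<cdot>\<^sub>m sigma_x"
  "sigma_z * sigma_x = \<i> \<cdot>\<^sub>m sigma_y" "sigma_x * sigma_z = (- \<i>) \<cdot>\<^sub>m sigma_y"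
  by (rule mat2_eqI; simp add: mat2_mult_index sigma_index carrier_matD[OF sigma_sq(1)]
      carrier_matD[OF sigma_sq(2)] carrier_matD[OF sigma_sq(3)] del: index_mult_mat(1))+

lemma sigma_one_mult [simp]:
  assumes "A \<in> pauli1" shows "1\<^sub>m 2 * A = A" "A * 1\<^sub>m 2 = A"
  using pauli1_sq[OF assms] by auto

lemma sigma_in [simp]: "1\<^sub>m 2 \<in> pauli1" "sigma_x \<in> pauli1" "sigma_y \<in> pauli1" "sigma_z \<in> pauli1"
  by (auto simp: pauli1_def)

lemma pauli1_adj: "A \<in> pauli1 \<Longrightarrow> mat_adjoint A = A"
  by (rule mat2_eqI) (auto simp: pauli1_def mat_adjoint_index[of _ 2] sigma_index)

lemma pauli1_square: "A \<in> pauli1 \<Longrightarrow> A * A = 1\<^sub>m 2"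
  by (auto simp: pauli1_def sigma_mult)

lemma pauli1_mult:
  assumes "A \<in> pauli1" "B \<in> pauli1"
  shows "\<exists>z\<in>phases. \<exists>C\<in>pauli1. A * B = z \<cdot>\<^sub>m C"
proof -
  have I: "\<exists>z\<in>phases. \<exists>C\<in>pauli1. A * B = z \<cdot>\<^sub>m C" if "A * B = z \<cdot>\<^sub>m C" "z \<in> phases" "C \<in> pauli1" for A B z C
    using that by blast
  have one: "1\<^sub>m 2 * C = 1 \<cdot>\<^sub>m C" "C * 1\<^sub>m 2 = 1 \<cdot>\<^sub>m C" if "C \<in> pauli1" for C
    using that by simp_all
  note one' = one[OF sigma_in(1)] one[OF sigma_in(2)] one[OF sigma_in(3)] one[OF sigma_in(4)]
  have sq: "C * C = 1 \<cdot>\<^sub>m 1\<^sub>m 2" if "C \<in> {sigma_x, sigma_y, sigma_z}" for C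
    using that by (auto simp: sigma_mult)
  \<comment> \<open>Of the sixteen products, each has an identity factor, or is a square, or is one
    of the six mixed products tabulated in \<open>sigma_mult\<close>.\<close>
  have "\<forall>A\<in>{1\<^sub>m 2, sigma_x, sigma_y, sigma_z}. \<forall>B\<in>{1\<^sub>m 2, sigma_x, sigma_y, sigma_z}.
      \<exists>z\<in>phases. \<exists>C\<in>pauli1. A * B = z \<cdot>\<^sub>m C"
    unfolding ball_simps
    by (intro conjI TrueI; rule I, (rule one' sigma_mult(4-9) | (rule sq, simp)))
      simp_all
  with assms show ?thesis unfolding pauli1_def[symmetric] by blast
qed

lemma pauli1_commute: "A \<in> pauli1 \<Longrightarrow> B \<in> pauli1 \<Longrightarrow> A * B = B * A \<or> A * B = (- 1) \<cdot>\<^sub>m (B * A)"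
  by (auto simp: pauli1_def sigma_mult)

lemma sigma_distinct:
  "1\<^sub>m 2 \<noteq> sigma_x" "1\<^sub>m 2 \<noteq> sigma_y" "1\<^sub>m 2 \<noteq> sigma_z"
  "sigma_x \<noteq> sigma_y" "sigma_x \<noteq> sigma_z" "sigma_y \<noteq> sigma_z"
proof -
  have ne: "A \<noteq> B" if "A $$ (0, i) \<noteq> B $$ (0, i)" for A B :: "complex mat" and i
    using that by auto
  show "1\<^sub>m 2 \<noteq> sigma_x" "1\<^sub>m 2 \<noteq> sigma_y" "sigma_x \<noteq> sigma_z" "sigma_y \<noteq> sigma_z"
    by (rule ne[of _ 0], simp add: sigma_index)+
  show "sigma_x \<noteq> sigma_y"
    by (rule ne[of _ 1]) (simp add: sigma_index complex_eq_iff)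
  show "1\<^sub>m 2 \<noteq> sigma_z"
  proof
    assume "1\<^sub>m 2 = sigma_z"
    then have "1\<^sub>m 2 $$ (1, 1) = sigma_z $$ (1, 1)" by simp
    then show False by (simp add: sigma_index)
  qed
qed

lemma pauli1_tr: "A \<in> pauli1 \<Longrightarrow> B \<in> pauli1 \<Longrightarrow> tr (A * B) = (if A = B then 2 else 0)"
proof -
  have "tr (1\<^sub>m 2) = 2" "tr sigma_x = 0" "tr sigma_y = 0" "tr sigma_z = 0"
    by (simp_all add: tr_def sum_2 sigma_index carrier_matD[OF sigma_sq(1)]
      carrier_matD[OF sigma_sq(2)] carrier_matD[OF sigma_sq(3)])
  then show "A \<in> pauli1 \<Longrightarrow> B \<in> pauli1 \<Longrightarrow> tr (A * B) = (if A = B then 2 else 0)"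
    using sigma_distinct sigma_distinct[symmetric]
    by (auto simp: pauli1_def sigma_mult tr_smult[of _ 2])
qed

text \<open>Completeness of the four Pauli matrices as an orthogonal operator basis, written
  entrywise: the counterpart of the trace orthogonality in \<open>pauli1_tr\<close>.\<close>

lemma pauli1_complete:
  assumes "r < 2" "c < 2" "r' < 2" "c' < 2"
  shows "(\<Sum>A\<in>pauli1. A $$ (r, c) * cnj (A $$ (r', c'))) = (if r = r' \<and> c = c' then 2 else 0)"
  using assms sigma_distinct unfolding less_2_cases_iff
  by (elim disjE) (simp_all add: pauli1_def sigma_index)

lemma finite_pauli1 [simp]: "finite pauli1"
  by (simp add: pauli1_def)

text \<open>Pauli operators stripped of their phase: hermitian, squaring to the identity and
  mutually orthogonal, hence suited as an operator basis.\<close>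

definition strings :: "nat \<Rightarrow> complex mat set" where
  "strings N = wedge_list ` {As. length As = N \<and> set As \<subseteq> pauli1}"

lemma strings_0: "strings 0 = {1\<^sub>m 1}"
  by (auto simp: strings_def)

lemma strings_Suc: "strings (Suc N) = (\<lambda>(A, B). wedge 1 N A B) ` (pauli1 \<times> strings N)"
proof -
  have "{As. length As = Suc N \<and> set As \<subseteq> pauli1} =
      (\<lambda>(A, As). A # As) ` (pauli1 \<times> {As. length As = N \<and> set As \<subseteq> pauli1})"
    by (auto simp: length_Suc_conv image_iff)
  then show ?thesis by (force simp: strings_def image_iff)
qed

lemma pauli_strings: "pauli N = {z \<cdot>\<^sub>m A | z A. z \<in> phases \<and> A \<in> strings N}"
  unfolding pauli_def strings_def phases_def pauli1_def by blast

lemma wedge1_sq [simp]: "wedge (Suc 0) N A B \<in> sq (2 ^ Suc N)"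
  using wedge_carrier[of "Suc 0" N A B] by simp

lemma strings_sq [simp]: "A \<in> strings N \<Longrightarrow> A \<in> sq (2 ^ N)"
proof (cases N)
  case (Suc M)
  assume "A \<in> strings N"
  then obtain B C where "A = wedge (Suc 0) M B C" by (auto simp: strings_Suc Suc)
  with wedge1_sq[of M B C] show ?thesis by (simp only: Suc)
qed (simp add: strings_0)

lemma wedge1_mult:
  "A \<in> sq 2 \<Longrightarrow> C \<in> sq 2 \<Longrightarrow> B \<in> sq (2 ^ N) \<Longrightarrow> D \<in> sq (2 ^ N) \<Longrightarrow>
    wedge (Suc 0) N A B * wedge (Suc 0) N C D = wedge (Suc 0) N (A * C) (B * D)"
  using wedge_mult[of A "Suc 0" C B N D] by simp

lemma wedge1_one: "wedge (Suc 0) N (1\<^sub>m 2) (1\<^sub>m (2 ^ N)) = 1\<^sub>m (2 ^ Suc N)"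
  using wedge_one[of "Suc 0" N] by simp

lemma wedge1_smult:
  "A \<in> sq 2 \<Longrightarrow> B \<in> sq (2 ^ N) \<Longrightarrow>
    wedge (Suc 0) N (y \<cdot>\<^sub>m A) (z \<cdot>\<^sub>m B) = (y * z) \<cdot>\<^sub>m wedge (Suc 0) N A B"
  using wedge_smult[of A "Suc 0" B N y z] by simp

lemma strings_adj: "A \<in> strings N \<Longrightarrow> mat_adjoint A = A"
proof (induction N arbitrary: A)
  case 0
  then show ?case by (simp add: strings_0)
next
  case (Suc N)
  then obtain B C where "B \<in> pauli1" "C \<in> strings N" "A = wedge 1 N B C"
    by (auto simp: strings_Suc)
  with Suc.IH show ?case using wedge_adj[of B 1 C N] by (simp add: pauli1_adj)
qed

lemma strings_square: "A \<in> strings N \<Longrightarrow> A * A = 1\<^sub>m (2 ^ N)"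
proof (induction N arbitrary: A)
  case 0
  then show ?case by (simp add: strings_0)
next
  case (Suc N)
  then obtain B C where "B \<in> pauli1" "C \<in> strings N" "A = wedge 1 N B C"
    by (auto simp: strings_Suc)
  with Suc.IH show ?case by (simp add: wedge1_mult pauli1_square wedge1_one del: power_Suc)
qed

lemma strings_mult:
  "A \<in> strings N \<Longrightarrow> B \<in> strings N \<Longrightarrow> \<exists>z\<in>phases. \<exists>C\<in>strings N. A * B = z \<cdot>\<^sub>m C"
proof (induction N arbitrary: A B)
  case 0
  then show ?case by (auto simp: strings_0 intro!: bexI[of _ 1])
next
  case (Suc N)
  then obtain A1 A2 B1 B2 where 1: "A1 \<in> pauli1" "A2 \<in> strings N" "A = wedge 1 N A1 A2"
    "B1 \<in> pauli1" "B2 \<in> strings N" "B = wedge 1 N B1 B2"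
    by (auto simp: strings_Suc)
  obtain y C where C: "y \<in> phases" "C \<in> pauli1" "A1 * B1 = y \<cdot>\<^sub>m C"
    using pauli1_mult 1 by blast
  obtain z D where D: "z \<in> phases" "D \<in> strings N" "A2 * B2 = z \<cdot>\<^sub>m D"
    using Suc.IH 1 by blast
  have "A * B = (y * z) \<cdot>\<^sub>m wedge 1 N C D"
    using 1 C D by (simp add: wedge1_mult wedge1_smult)
  moreover have "wedge 1 N C D \<in> strings (Suc N)" using C D by (auto simp: strings_Suc)
  ultimately show ?case using C(1) D(1) phases_mult by blast
qed

lemma strings_commute:
  "A \<in> strings N \<Longrightarrow> B \<in> strings N \<Longrightarrow> A * B = B * A \<or> A * B = (- 1) \<cdot>\<^sub>m (B * A)"
proof (induction N arbitrary: A B)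
  case 0
  then show ?case by (simp add: strings_0)
next
  case (Suc N)
  then obtain A1 A2 B1 B2 where 1: "A1 \<in> pauli1" "A2 \<in> strings N" "A = wedge 1 N A1 A2"
    "B1 \<in> pauli1" "B2 \<in> strings N" "B = wedge 1 N B1 B2"
    by (auto simp: strings_Suc)
  obtain y where y: "y = 1 \<or> y = - 1" "A1 * B1 = y \<cdot>\<^sub>m (B1 * A1)"
    using pauli1_commute[OF 1(1,4)] by (metis one_smult_mat)
  obtain z where z: "z = 1 \<or> z = - 1" "A2 * B2 = z \<cdot>\<^sub>m (B2 * A2)"
    using Suc.IH[OF 1(2,5)] by (metis one_smult_mat)
  have "A * B = (y * z) \<cdot>\<^sub>m (B * A)"
    using 1 by (simp add: wedge1_mult wedge1_smult y(2) z(2))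
  then show ?case using y(1) z(1) by auto
qed

lemma tr_wedge1:
  assumes "A \<in> sq 2" "B \<in> sq (2 ^ N)"
  shows "tr (wedge (Suc 0) N A B) = tr A * tr B"
proof -
  have "tr (wedge (Suc 0) N A B) = (\<Sum>k<2 ^ (Suc 0 + N). A $$ (k div 2 ^ N, k div 2 ^ N) * B $$ (k mod 2 ^ N, k mod 2 ^ N))"
    unfolding tr_def carrier_matD[OF wedge_carrier]
    by (rule sum.cong) (simp_all add: wedge_index del: add_Suc)
  also have "\<dots> = tr A * tr B"
    using assms sum_div_mod[where f = "\<lambda>x y. A $$ (x, x) * B $$ (y, y)" and N = "Suc 0" and M = N]
    by (simp add: tr_def sum_product del: add_Suc)
  finally show ?thesis .
qed

text \<open>Orthogonality for the Hilbert-Schmidt inner product. The trace is multiplicative over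
  wedge factors, so the one-mode relation propagates by induction.\<close>

lemma strings_tr: "A \<in> strings N \<Longrightarrow> B \<in> strings N \<Longrightarrow> tr (A * B) = (if A = B then 2 ^ N else 0)"
proof (induction N arbitrary: A B)
  case 0
  then show ?case by (simp add: strings_0 tr_def)
next
  case (Suc N)
  then obtain A1 A2 B1 B2 where 1: "A1 \<in> pauli1" "A2 \<in> strings N" "A = wedge 1 N A1 A2"
    "B1 \<in> pauli1" "B2 \<in> strings N" "B = wedge 1 N B1 B2"
    by (auto simp: strings_Suc)
  have eq: "tr (A * B) = (if A1 = B1 \<and> A2 = B2 then 2 ^ Suc N else 0)"
    using 1 by (simp add: wedge1_mult tr_wedge1 pauli1_tr Suc.IH)
  \<comment> \<open>Equal wedges must be shown to have equal factors. The trace does this: if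
    \<open>A = B\<close>, then \<open>A * B\<close> is the identity, whose trace is nonzero, which
    \<open>eq\<close> allows only for equal factors.\<close>
  have "A = B \<longleftrightarrow> A1 = B1 \<and> A2 = B2"
  proof
    assume "A = B"
    then have "tr (A * B) = tr (1\<^sub>m (2 ^ Suc N))" using strings_square[OF Suc.prems(2)] by simp
    then have "tr (A * B) \<noteq> 0" by (simp add: tr_def)
    with eq show "A1 = B1 \<and> A2 = B2" by (simp split: if_splits)
  qed (simp add: 1)
  with eq show ?case by simp
qed

lemma finite_strings [simp]: "finite (strings N)"
  by (induction N) (auto simp: strings_0 strings_Suc)

text \<open>The trace of a product of two wedges vanishes unless the factors agree. Injectivity lets
  a sum over \<open>strings (Suc N)\<close> be rewritten as a double sum.\<close>

lemma inj_wedge_strings: "inj_on (\<lambda>(A, B). wedge 1 N A B) (pauli1 \<times> strings N)"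
proof (rule inj_onI, clarsimp)
  fix A1 A2 B1 B2
  assume 1: "A1 \<in> pauli1" "A2 \<in> strings N" "B1 \<in> pauli1" "B2 \<in> strings N"
    and eq: "wedge (Suc 0) N A1 A2 = wedge (Suc 0) N B1 B2"
  have "tr (wedge (Suc 0) N A1 A2 * wedge (Suc 0) N B1 B2) = tr (wedge (Suc 0) N B1 B2 * wedge (Suc 0) N B1 B2)"
    by (simp add: eq)
  with 1 have "tr (A1 * B1) * tr (A2 * B2) = 2 * 2 ^ N"
    by (simp add: wedge1_mult tr_wedge1 pauli1_tr strings_tr)
  with 1 show "A1 = B1 \<and> A2 = B2"
    by (simp add: pauli1_tr strings_tr split: if_splits)
qed

text \<open>The sum factorizes over the first mode and the remaining ones. This identity drives the
  commutant lemma, the Pauli expansion and the appearance of the swap operator.\<close>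

lemma strings_complete:
  assumes "r < 2 ^ N" "c < 2 ^ N" "r' < 2 ^ N" "c' < 2 ^ N"
  shows "(\<Sum>A\<in>strings N. A $$ (r, c) * cnj (A $$ (r', c'))) = (if r = r' \<and> c = c' then 2 ^ N else 0)"
  using assms
proof (induction N arbitrary: r c r' c')
  case 0
  then show ?case by (simp add: strings_0)
next
  case (Suc N)
  let ?d = "\<lambda>x. x div 2 ^ N" and ?m = "\<lambda>x. x mod (2 :: nat) ^ N"
  have b: "?d x < 2" "?m x < 2 ^ N" "x < 2 ^ (Suc 0 + N)" if "x < 2 ^ Suc N" for x
    using that div_mod_less[of x 1 N] by auto
  note bs = b[OF Suc.prems(1)] b[OF Suc.prems(2)] b[OF Suc.prems(3)] b[OF Suc.prems(4)]
  have "(\<Sum>A\<in>strings (Suc N). A $$ (r, c) * cnj (A $$ (r', c'))) =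
      (\<Sum>(A, B)\<in>pauli1 \<times> strings N. (A $$ (?d r, ?d c) * cnj (A $$ (?d r', ?d c'))) *
        (B $$ (?m r, ?m c) * cnj (B $$ (?m r', ?m c'))))"
    unfolding strings_Suc sum.reindex[OF inj_wedge_strings]
    by (rule sum.cong) (auto simp: wedge_index bs simp del: add_Suc)
  also have "\<dots> = (if ?d r = ?d r' \<and> ?d c = ?d c' then 2 else 0) *
      (if ?m r = ?m r' \<and> ?m c = ?m c' then 2 ^ N else 0)"
    using bs by (simp add: sum.cartesian_product[symmetric] sum_product[symmetric] pauli1_complete Suc.IH)
  also have "\<dots> = (if r = r' \<and> c = c' then 2 ^ Suc N else 0)"
  proof -
    have "x = y \<longleftrightarrow> ?d x = ?d y \<and> ?m x = ?m y" for x y by (metis div_mult_mod_eq)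
    from this[of r r'] this[of c c'] show ?thesis by auto
  qed
  finally show ?case .
qed

subsection \<open>The Pauli group\<close>

lemma strings_one [simp]: "1\<^sub>m (2 ^ N) \<in> strings N"
proof (induction N)
  case (Suc N)
  then show ?case using wedge1_one[of N] unfolding strings_Suc
    by (intro image_eqI[of _ _ "(1\<^sub>m 2, 1\<^sub>m (2 ^ N))"]) simp_all
qed (simp add: strings_0)

lemma pauliE:
  assumes "\<Gamma> \<in> pauli N"
  obtains z A where "z \<in> phases" "A \<in> strings N" "\<Gamma> = z \<cdot>\<^sub>m A"
  using assms by (auto simp: pauli_strings)

lemma pauli_smult [simp]: "z \<in> phases \<Longrightarrow> \<Gamma> \<in> pauli N \<Longrightarrow> z \<cdot>\<^sub>m \<Gamma> \<in> pauli N"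
  unfolding pauli_strings by (clarsimp, metis phases_mult)

lemma strings_pauli [simp]: "A \<in> strings N \<Longrightarrow> A \<in> pauli N"
  unfolding pauli_strings by (intro CollectI exI[of _ 1] exI[of _ A]) simp

lemma pauli_sq [simp]: "\<Gamma> \<in> pauli N \<Longrightarrow> \<Gamma> \<in> sq (2 ^ N)"
  by (auto elim!: pauliE)

lemma finite_pauli [simp]: "finite (pauli N)"
proof -
  have "pauli N = (\<lambda>(z, A). z \<cdot>\<^sub>m A) ` (phases \<times> strings N)"
    by (auto simp: pauli_strings)
  then show ?thesis by (simp add: phases_def)
qed

lemma pauli_mult [simp]:
  assumes "\<Gamma> \<in> pauli N" "\<Delta> \<in> pauli N"
  shows "\<Gamma> * \<Delta> \<in> pauli N"
proof -
  obtain y z A B where 1: "y \<in> phases" "z \<in> phases" "A \<in> strings N" "B \<in> strings N"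
    "\<Gamma> = y \<cdot>\<^sub>m A" "\<Delta> = z \<cdot>\<^sub>m B"
    using assms by (elim pauliE) blast
  obtain x C where C: "x \<in> phases" "C \<in> strings N" "A * B = x \<cdot>\<^sub>m C"
    using strings_mult 1 by blast
  have "\<Gamma> * \<Delta> = (y * z * x) \<cdot>\<^sub>m C" using 1 C by (simp add: sq_simps[of _ "2 ^ N"] mult_ac)
  then show ?thesis using 1 C by simp
qed

lemma pauli_adj [simp]: "\<Gamma> \<in> pauli N \<Longrightarrow> mat_adjoint \<Gamma> \<in> pauli N"
  by (auto elim!: pauliE simp: mat_adjoint_smult[of _ "2 ^ N"] strings_adj)

lemma pauli_unitary:
  assumes "\<Gamma> \<in> pauli N"
  shows "unitary_op N \<Gamma>"
  using assms
  by (auto elim!: pauliE simp: unitary_op_def mat_adjoint_smult[of _ "2 ^ N"] strings_adj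
      sq_simps[of _ "2 ^ N"] strings_square phases_unit mult.commute)

lemma pauli_commute:
  assumes "\<Gamma> \<in> pauli N" "\<Delta> \<in> pauli N"
  shows "\<Gamma> * \<Delta> = \<Delta> * \<Gamma> \<or> \<Gamma> * \<Delta> = (- 1) \<cdot>\<^sub>m (\<Delta> * \<Gamma>)"
proof -
  obtain y z A B where 1: "y \<in> phases" "z \<in> phases" "A \<in> strings N" "B \<in> strings N"
    "\<Gamma> = y \<cdot>\<^sub>m A" "\<Delta> = z \<cdot>\<^sub>m B"
    using assms by (elim pauliE) blast
  have "A * B = B * A \<or> A * B = (- 1) \<cdot>\<^sub>m (B * A)" using strings_commute 1 by blast
  then show ?thesis using 1 by (auto simp: sq_simps[of _ "2 ^ N"] mult_ac)
qed

text \<open>A Schur lemma for the Pauli group: every \<open>A * D * A\<close> equals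
  \<open>D\<close> by commutation, while completeness turns the sum of all these conjugates into a
  multiple of the identity.\<close>

lemma pauli_commutant_scalar:
  assumes D: "D \<in> sq (2 ^ N)" and comm: "\<And>A. A \<in> strings N \<Longrightarrow> A * D = D * A"
  shows "\<exists>z. D = z \<cdot>\<^sub>m 1\<^sub>m (2 ^ N)"
proof
  let ?n = "2 ^ N :: nat"
  have pos: "card (strings N) \<noteq> 0" using strings_one by (metis card_0_eq empty_iff finite_strings)
  \<comment> \<open>The scalar comes from the conjugates adding up to \<open>2 ^ N * tr D\<close>
    times the identity; the number of strings enters only as a nonzero divisor.\<close>
  show "D = (2 ^ N * tr D / of_nat (card (strings N))) \<cdot>\<^sub>m 1\<^sub>m (2 ^ N)"
  proof (rule sq_eqI[of _ ?n])
    fix r c assume rc: "r < ?n" "c < ?n"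
    have "D $$ (r, c) = (\<Sum>l<?n. \<Sum>k<?n. D $$ (k, l) * (A $$ (r, k) * cnj (A $$ (c, l))))"
      if A: "A \<in> strings N" for A
    proof -
      have "D = A * D * A"
        using D A by (simp add: comm strings_square sq_assoc[of _ ?n])
      also have "(A * D * A) $$ (r, c) = (\<Sum>l<?n. (A * D) $$ (r, l) * A $$ (l, c))"
        using D A rc by (intro sq_mult_index) simp_all
      also have "\<dots> = (\<Sum>l<?n. \<Sum>k<?n. D $$ (k, l) * (A $$ (r, k) * cnj (A $$ (c, l))))"
      proof (intro sum.cong refl)
        fix l assume l: "l \<in> {..<?n}"
        have "A $$ (l, c) = mat_adjoint A $$ (l, c)" using A by (simp add: strings_adj)
        also have "\<dots> = cnj (A $$ (c, l))"
          using A l rc by (intro mat_adjoint_index) simp_all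
        finally show "(A * D) $$ (r, l) * A $$ (l, c) =
            (\<Sum>k<?n. D $$ (k, l) * (A $$ (r, k) * cnj (A $$ (c, l))))"
          using A D l rc by (simp add: sq_mult_index[of _ ?n] sum_distrib_right sum_distrib_left mult_ac
              del: index_mult_mat(1))
      qed
      finally show ?thesis .
    qed
    note D_eq = this
    have "of_nat (card (strings N)) * D $$ (r, c) = (\<Sum>A\<in>strings N. D $$ (r, c))"
      by simp
    also have "\<dots> =
        (\<Sum>A\<in>strings N. \<Sum>l<?n. \<Sum>k<?n. D $$ (k, l) * (A $$ (r, k) * cnj (A $$ (c, l))))"
      by (intro sum.cong refl D_eq)
    also have "\<dots> = (\<Sum>l<?n. \<Sum>k<?n. D $$ (k, l) * (\<Sum>A\<in>strings N. A $$ (r, k) * cnj (A $$ (c, l))))"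
      by (simp add: sum_distrib_left sum.swap[of _ _ "strings N"])
    also have "\<dots> = (\<Sum>l<?n. \<Sum>k<?n. if k = l then if r = c then D $$ (l, l) * 2 ^ N else 0 else 0)"
      using rc by (intro sum.cong refl) (simp add: strings_complete)
    also have "\<dots> = (if r = c then 2 ^ N * tr D else 0)"
      using D by (simp add: tr_def sum_distrib_left mult.commute)
    finally show "D $$ (r, c) = ((2 ^ N * tr D / of_nat (card (strings N))) \<cdot>\<^sub>m 1\<^sub>m (2 ^ N)) $$ (r, c)"
      using rc pos by (auto simp: field_simps)
  qed (use D in simp_all)
qed

subsection \<open>Parity\<close>

abbreviation (input) ev :: "nat \<Rightarrow> nat \<Rightarrow> bool" where
  "ev N x \<equiv> even (length (occupied N x))"

lemma S_z_string [simp]: "S_z N \<in> strings N"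
  unfolding S_z_def strings_def by (rule image_eqI[OF refl]) (simp add: set_replicate_conv_if)

text \<open>\<open>S_z N\<close> is the total parity operator. Splitting off the most significant
  mode adds its occupation to the particle number, which matches the sign of
  \<open>sigma_z\<close>.\<close>

lemma S_z_index:
  "r < 2 ^ N \<Longrightarrow> c < 2 ^ N \<Longrightarrow> S_z N $$ (r, c) = (if r = c then if ev N r then 1 else - 1 else 0)"
proof (induction N arbitrary: r c)
  case 0
  then show ?case by (simp add: S_z_def occupied_def)
next
  case (Suc N)
  let ?d = "\<lambda>x. x div 2 ^ N" and ?m = "\<lambda>x. x mod (2 :: nat) ^ N"
  have b: "?d x < 2" "?m x < 2 ^ N" "x < 2 ^ (Suc 0 + N)" if "x < 2 ^ Suc N" for x
    using that div_mod_less[of x 1 N] by auto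
  note bs = b[OF Suc.prems(1)] b[OF Suc.prems(2)]
  have occ1: "length (occupied 1 x) = x" if "x < 2" for x
    using that by (auto simp: less_2_cases_iff occupied_def occ_def bit_Suc_0_iff)
  have "length (occupied (1 + N) (?d r * 2 ^ N + ?m r)) = ?d r + length (occupied N (?m r))"
    using bs occ1[of "?d r"] by (subst occupied_wedge) simp_all
  then have 1: "length (occupied (Suc N) r) = ?d r + length (occupied N (?m r))"
    by (simp add: div_mult_mod_eq)
  have "x = y \<longleftrightarrow> ?d x = ?d y \<and> ?m x = ?m y" for x y by (metis div_mult_mod_eq)
  note 2 = this[of r c]
  have "S_z (Suc N) $$ (r, c) = sigma_z $$ (?d r, ?d c) * S_z N $$ (?m r, ?m c)"
    using bs by (simp add: S_z_def wedge_index del: add_Suc)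
  also have "\<dots> = (if ?d r = ?d c \<and> ?m r = ?m c then if ev (Suc N) r then 1 else - 1 else 0)"
    using bs unfolding 1 by (auto simp: sigma_index Suc.IH less_2_cases_iff)
  finally show ?case using 2 by simp
qed

section \<open>Block types as zero patterns and as commutation relations\<close>

lemma ketbra_index:
  assumes "x < 2 ^ N" "y < 2 ^ N" "r < 2 ^ N" "c < 2 ^ N"
  shows "ketbra N x y $$ (r, c) = (if r = x \<and> c = y then 1 else 0)"
  using assms by (auto simp: ketbra_def outer_def ket_eq_unit_vec)

lemma ketbra_sq: "x < 2 ^ N \<Longrightarrow> y < 2 ^ N \<Longrightarrow> ketbra N x y \<in> sq (2 ^ N)"
  by (simp add: ketbra_def outer_def ket_eq_unit_vec)

lemma op_sum_sq [simp]: "op_sum d f I \<in> sq d"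
  by (simp add: op_sum_def)

lemma op_sum_ketbra:
  assumes I: "I \<subseteq> {..<2 ^ N} \<times> {..<2 ^ N}" and rc: "r < 2 ^ N" "c < 2 ^ N"
  shows "op_sum (2 ^ N) (\<lambda>(x, y). a x y \<cdot>\<^sub>m ketbra N x y) I $$ (r, c) = (if (r, c) \<in> I then a r c else 0)"
proof -
  have "op_sum (2 ^ N) (\<lambda>(x, y). a x y \<cdot>\<^sub>m ketbra N x y) I $$ (r, c) =
      (\<Sum>p\<in>I. if p = (r, c) then a r c else 0)"
    unfolding op_sum_def index_mat(1)[OF rc] prod.case
  proof (rule sum.cong[OF refl])
    fix p assume "p \<in> I"
    then obtain x y where p: "p = (x, y)" "x < 2 ^ N" "y < 2 ^ N" using I by auto
    have "(a x y \<cdot>\<^sub>m ketbra N x y) $$ (r, c) = a x y * ketbra N x y $$ (r, c)"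
      using ketbra_sq[OF p(2,3)] rc by (intro index_smult_mat(1)) auto
    with p rc show "(case p of (x, y) \<Rightarrow> a x y \<cdot>\<^sub>m ketbra N x y) $$ (r, c) = (if p = (r, c) then a r c else 0)"
      by (auto simp: ketbra_index simp del: index_smult_mat)
  qed
  also have "finite I" using I by (rule finite_subset) simp
  then have "(\<Sum>p\<in>I. if p = (r, c) then a r c else 0) = (if (r, c) \<in> I then a r c else 0)"
    by (simp add: sum.delta')
  finally show ?thesis .
qed

lemma ev_iff: "x \<in> even_states N \<longleftrightarrow> x < 2 ^ N \<and> ev N x" "x \<in> odd_states N \<longleftrightarrow> x < 2 ^ N \<and> \<not> ev N x"
  by (auto simp: even_states_def odd_states_def)

text \<open>The operators \<open>ketbra N x y\<close> are matrix units, so the span of a family of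
  them is fixed by which entries must vanish.\<close>

lemma span_ketbra_iff:
  assumes I: "I \<subseteq> {..<2 ^ N} \<times> {..<2 ^ N}"
  shows "(\<exists>a. A = op_sum (2 ^ N) (\<lambda>(x, y). a x y \<cdot>\<^sub>m ketbra N x y) I) \<longleftrightarrow>
    A \<in> sq (2 ^ N) \<and> (\<forall>r<2 ^ N. \<forall>c<2 ^ N. (r, c) \<notin> I \<longrightarrow> A $$ (r, c) = 0)"
proof
  assume R: "A \<in> sq (2 ^ N) \<and> (\<forall>r<2 ^ N. \<forall>c<2 ^ N. (r, c) \<notin> I \<longrightarrow> A $$ (r, c) = 0)"
  then have "A = op_sum (2 ^ N) (\<lambda>(x, y). A $$ (x, y) \<cdot>\<^sub>m ketbra N x y) I"
    by (intro sq_eqI[of _ "2 ^ N"]) (auto simp: op_sum_ketbra[OF I, of _ _ "\<lambda>x y. A $$ (x, y)"])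
  then show "\<exists>a. A = op_sum (2 ^ N) (\<lambda>(x, y). a x y \<cdot>\<^sub>m ketbra N x y) I"
    by (rule exI[of _ "\<lambda>x y. A $$ (x, y)"])
qed (auto simp: op_sum_ketbra[OF I])

lemma block_diagonal_entries:
  "block_diagonal N A \<longleftrightarrow>
    A \<in> sq (2 ^ N) \<and> (\<forall>r<2 ^ N. \<forall>c<2 ^ N. ev N r \<noteq> ev N c \<longrightarrow> A $$ (r, c) = 0)"
  unfolding block_diagonal_def by (subst span_ketbra_iff) (auto simp: ev_iff)

lemma anti_block_diagonal_entries:
  "anti_block_diagonal N A \<longleftrightarrow>
    A \<in> sq (2 ^ N) \<and> (\<forall>r<2 ^ N. \<forall>c<2 ^ N. ev N r = ev N c \<longrightarrow> A $$ (r, c) = 0)"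
  unfolding anti_block_diagonal_def by (subst span_ketbra_iff) (auto simp: ev_iff)

lemma S_z_mult_index:
  assumes "A \<in> sq (2 ^ N)" "r < 2 ^ N" "c < 2 ^ N"
  shows "(A * S_z N) $$ (r, c) = (if ev N c then 1 else - 1) * A $$ (r, c)"
    and "(S_z N * A) $$ (r, c) = (if ev N r then 1 else - 1) * A $$ (r, c)"
  using assms
  by (simp_all add: sq_mult_index[of _ "2 ^ N"] S_z_index if_distrib[of "\<lambda>x. x * _"] if_distrib[of "(*) _"]
      sum.delta sum.delta' del: index_mult_mat(1) cong: if_cong)

text \<open>Multiplying by \<open>S_z N\<close> on the right or left puts the column or row parity
  in front of an entry. The two products agree exactly when entries between different parities
  vanish.\<close>

lemma block_diagonal_iff: "block_diagonal N A \<longleftrightarrow> A \<in> sq (2 ^ N) \<and> A * S_z N = S_z N * A"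
  (is "_ \<longleftrightarrow> ?R")
proof
  assume "block_diagonal N A"
  then show ?R unfolding block_diagonal_entries
    by (auto intro!: sq_eqI[of _ "2 ^ N"] simp: S_z_mult_index simp del: index_mult_mat(1))
next
  assume R: ?R
  have "A $$ (r, c) = 0" if "r < 2 ^ N" "c < 2 ^ N" "ev N r \<noteq> ev N c" for r c
  proof -
    have "(A * S_z N) $$ (r, c) = (S_z N * A) $$ (r, c)" using R by simp
    then show ?thesis using that conjunct1[OF R] by (simp add: S_z_mult_index del: index_mult_mat(1) split: if_splits)
  qed
  with R show "block_diagonal N A" by (simp add: block_diagonal_entries)
qed

lemma anti_block_diagonal_iff:
  "anti_block_diagonal N A \<longleftrightarrow> A \<in> sq (2 ^ N) \<and> A * S_z N = (- 1) \<cdot>\<^sub>m (S_z N * A)"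
  (is "_ \<longleftrightarrow> ?R")
proof
  assume "anti_block_diagonal N A"
  then show ?R unfolding anti_block_diagonal_entries
    by (auto intro!: sq_eqI[of _ "2 ^ N"] simp: S_z_mult_index carrier_matD[OF strings_sq[OF S_z_string]] simp del: index_mult_mat(1))
next
  assume R: ?R
  have "A $$ (r, c) = 0" if "r < 2 ^ N" "c < 2 ^ N" "ev N r = ev N c" for r c
  proof -
    have "(A * S_z N) $$ (r, c) = ((- 1) \<cdot>\<^sub>m (S_z N * A)) $$ (r, c)" using R by simp
    then show ?thesis using that conjunct1[OF R]
      by (simp add: S_z_mult_index carrier_matD[OF strings_sq[OF S_z_string]] del: index_mult_mat(1) split: if_splits)
  qed
  with R show "anti_block_diagonal N A" by (simp add: anti_block_diagonal_entries)
qed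

lemma pauli_BD_iff: "\<Gamma> \<in> pauli_BD N \<longleftrightarrow> \<Gamma> \<in> pauli N \<and> \<Gamma> * S_z N = S_z N * \<Gamma>"
  by (auto simp: pauli_BD_def block_diagonal_iff)

lemma pauli_ABD_iff: "\<Gamma> \<in> pauli_ABD N \<longleftrightarrow> \<Gamma> \<in> pauli N \<and> \<Gamma> * S_z N = (- 1) \<cdot>\<^sub>m (S_z N * \<Gamma>)"
  by (auto simp: pauli_ABD_def anti_block_diagonal_iff)

text \<open>A Pauli operator commutes or anticommutes with the parity \<open>S_z N\<close>, itself a
  string, so it always has a definite block type.\<close>

lemma pauli_cases: "\<Gamma> \<in> pauli N \<Longrightarrow> \<Gamma> \<in> pauli_BD N \<or> \<Gamma> \<in> pauli_ABD N"
  using pauli_commute[of \<Gamma> N "S_z N"] by (auto simp: pauli_BD_iff pauli_ABD_iff)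

lemma smult_neg1_neq:
  assumes "\<Gamma> \<in> pauli N"
  shows "\<Gamma> \<noteq> (- 1) \<cdot>\<^sub>m \<Gamma>"
proof
  assume eq: "\<Gamma> = (- 1) \<cdot>\<^sub>m \<Gamma>"
  have s: "\<Gamma> \<in> sq (2 ^ N)" and u: "\<Gamma> * mat_adjoint \<Gamma> = 1\<^sub>m (2 ^ N)"
    using assms pauli_unitary[OF assms] by (simp_all add: unitary_op_def)
  have "(1\<^sub>m (2 ^ N) :: complex mat) = ((- 1) \<cdot>\<^sub>m \<Gamma>) * mat_adjoint \<Gamma>"
    by (simp only: u eq[symmetric])
  also have "\<dots> = (- 1) \<cdot>\<^sub>m 1\<^sub>m (2 ^ N)" using s u by (simp add: sq_smult_left[of _ "2 ^ N"])
  finally have "(1\<^sub>m (2 ^ N) :: complex mat) $$ (0, 0) = ((- 1) \<cdot>\<^sub>m 1\<^sub>m (2 ^ N)) $$ (0, 0)" by simp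
  then show False by simp
qed

section \<open>Entries of the sector projectors and sector swaps\<close>

lemma wedge_ketbra_index:
  assumes "i < 2 ^ N" "j < 2 ^ N" "k < 2 ^ N" "l < 2 ^ N" "r < 2 ^ (N + N)" "c < 2 ^ (N + N)"
  shows "wedge N N (ketbra N i j) (ketbra N k l) $$ (r, c) =
    (if r div 2 ^ N = i \<and> c div 2 ^ N = j \<and> r mod 2 ^ N = k \<and> c mod 2 ^ N = l then 1 else 0)"
  using assms by (simp add: wedge_index ketbra_index div_mod_less)

lemma op_sum_wedge_diag:
  assumes I: "I \<subseteq> {..<2 ^ N} \<times> {..<2 ^ N}" and rc: "r < 2 ^ (N + N)" "c < 2 ^ (N + N)"
  shows "op_sum (2 ^ (N + N)) (\<lambda>(i, j). wedge N N (ketbra N i i) (ketbra N j j)) I $$ (r, c) =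
    (if r = c \<and> (r div 2 ^ N, r mod 2 ^ N) \<in> I then 1 else 0)"
proof -
  have eq: "r = c \<longleftrightarrow> r div 2 ^ N = c div 2 ^ N \<and> r mod 2 ^ N = c mod 2 ^ N" by (metis div_mult_mod_eq)
  have "op_sum (2 ^ (N + N)) (\<lambda>(i, j). wedge N N (ketbra N i i) (ketbra N j j)) I $$ (r, c) =
      (\<Sum>p\<in>I. if p = (r div 2 ^ N, r mod 2 ^ N) then if r = c then 1 else 0 else 0)"
    unfolding op_sum_def index_mat(1)[OF rc] prod.case
    by (rule sum.cong[OF refl]) (use rc eq in \<open>auto simp: wedge_ketbra_index dest!: subsetD[OF I] split: if_splits\<close>)
  also have "finite I" using I by (rule finite_subset) simp
  then have "(\<Sum>p\<in>I. if p = (r div 2 ^ N, r mod 2 ^ N) then if r = c then 1 else 0 else 0) =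
      (if r = c \<and> (r div 2 ^ N, r mod 2 ^ N) \<in> I then 1 else 0 :: complex)"
    by (simp add: sum.delta')
  finally show ?thesis .
qed

lemma op_sum_wedge_swap:
  assumes I: "I \<subseteq> {..<2 ^ N} \<times> {..<2 ^ N}" and rc: "r < 2 ^ (N + N)" "c < 2 ^ (N + N)"
  shows "op_sum (2 ^ (N + N)) (\<lambda>(i, j). wedge N N (ketbra N i j) (ketbra N j i)) I $$ (r, c) =
    (if r div 2 ^ N = c mod 2 ^ N \<and> r mod 2 ^ N = c div 2 ^ N \<and> (r div 2 ^ N, r mod 2 ^ N) \<in> I
     then 1 else 0)"
proof -
  have "op_sum (2 ^ (N + N)) (\<lambda>(i, j). wedge N N (ketbra N i j) (ketbra N j i)) I $$ (r, c) =
      (\<Sum>p\<in>I. if p = (r div 2 ^ N, r mod 2 ^ N) then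
        if r div 2 ^ N = c mod 2 ^ N \<and> r mod 2 ^ N = c div 2 ^ N then 1 else 0 else 0)"
    unfolding op_sum_def index_mat(1)[OF rc] prod.case
    by (rule sum.cong[OF refl]) (use rc in \<open>auto simp: wedge_ketbra_index dest!: subsetD[OF I] split: if_splits\<close>)
  also have "finite I" using I by (rule finite_subset) simp
  then have "(\<Sum>p\<in>I. if p = (r div 2 ^ N, r mod 2 ^ N) then
        if r div 2 ^ N = c mod 2 ^ N \<and> r mod 2 ^ N = c div 2 ^ N then 1 else 0 else 0) =
      (if r div 2 ^ N = c mod 2 ^ N \<and> r mod 2 ^ N = c div 2 ^ N \<and> (r div 2 ^ N, r mod 2 ^ N) \<in> I
       then 1 else 0 :: complex)"
    by (simp add: sum.delta')
  finally show ?thesis .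
qed

lemma even_odd_subset:
  "even_states N \<subseteq> {..<2 ^ N}" "odd_states N \<subseteq> {..<2 ^ N}"
  by (auto simp: ev_iff)

lemmas pairs_subset = Sigma_mono[OF even_odd_subset(1) even_odd_subset(1)]
  Sigma_mono[OF even_odd_subset(2) even_odd_subset(2)]
  Sigma_mono[OF even_odd_subset(1) even_odd_subset(2)]
  Sigma_mono[OF even_odd_subset(2) even_odd_subset(1)]

lemma I_H_sq [simp]: "I_EE N \<in> sq (2 ^ (N + N))" "I_OO N \<in> sq (2 ^ (N + N))"
  "H_EE N \<in> sq (2 ^ (N + N))" "H_OO N \<in> sq (2 ^ (N + N))"
  by (simp_all add: I_EE_def I_OO_def H_EE_def H_OO_def)

text \<open>Here \<open>p\<close> says that both subsystems have equal parity and \<open>s\<close>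
  that row and column are exchanged pairs. Thus \<open>I_EE\<close> and \<open>I_OO\<close> are the
  projectors onto the total parity sectors, and \<open>H_EE\<close> and \<open>H_OO\<close> are the
  swap restricted to them.\<close>

lemma I_H_index:
  assumes rc: "r < 2 ^ (N + N)" "c < 2 ^ (N + N)"
  defines "p \<equiv> ev N (r div 2 ^ N) = ev N (r mod 2 ^ N)"
    and "s \<equiv> r div 2 ^ N = c mod 2 ^ N \<and> r mod 2 ^ N = c div 2 ^ N"
  shows "I_EE N $$ (r, c) = (if r = c \<and> p then 1 else 0)"
    "I_OO N $$ (r, c) = (if r = c \<and> \<not> p then 1 else 0)"
    "H_EE N $$ (r, c) = (if s \<and> p then 1 else 0)"
    "H_OO N $$ (r, c) = (if s \<and> \<not> p then 1 else 0)"
  unfolding I_EE_def I_OO_def H_EE_def H_OO_def p_def s_def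
  using rc by (auto simp: op_sum_wedge_diag[OF pairs_subset(1)] op_sum_wedge_diag[OF pairs_subset(2)]
      op_sum_wedge_diag[OF pairs_subset(3)] op_sum_wedge_diag[OF pairs_subset(4)]
      op_sum_wedge_swap[OF pairs_subset(1)] op_sum_wedge_swap[OF pairs_subset(2)]
      op_sum_wedge_swap[OF pairs_subset(3)] op_sum_wedge_swap[OF pairs_subset(4)]
      carrier_matD[OF op_sum_sq] ev_iff div_mod_less)

subsection \<open>The restricted Clifford group\<close>

definition cj :: "complex mat \<Rightarrow> complex mat \<Rightarrow> complex mat" where
  "cj C A = C * A * mat_adjoint C"

lemma unitary_sq [simp]: "unitary_op N C \<Longrightarrow> C \<in> sq (2 ^ N)"
  by (simp add: unitary_op_def)

lemma unitary_adj: "unitary_op N C \<Longrightarrow> unitary_op N (mat_adjoint C)"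
  by (auto simp: unitary_op_def)

lemma unitary_cancel:
  assumes "unitary_op N C" "A \<in> sq (2 ^ N)"
  shows "mat_adjoint C * (C * A) = A" "C * (mat_adjoint C * A) = A"
  using assms by (simp_all add: unitary_op_def sq_assoc[of _ "2 ^ N", symmetric])

lemma unitary_mult:
  assumes "unitary_op N C" "unitary_op N D"
  shows "unitary_op N (C * D)"
  using assms unfolding unitary_op_def
  by (auto simp: adj_mult[of _ "2 ^ N"] sq_assoc[of _ "2 ^ N"] unitary_cancel[unfolded unitary_op_def])

lemma cj_sq [simp]: "C \<in> sq n \<Longrightarrow> A \<in> sq n \<Longrightarrow> cj C A \<in> sq n"
  by (simp add: cj_def)

lemma cj_mult:
  assumes "unitary_op N C" "A \<in> sq (2 ^ N)" "B \<in> sq (2 ^ N)"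
  shows "cj C (A * B) = cj C A * cj C B"
  using assms by (simp add: cj_def sq_assoc[of _ "2 ^ N"] unitary_cancel)

lemma cj_smult: "C \<in> sq n \<Longrightarrow> A \<in> sq n \<Longrightarrow> cj C (z \<cdot>\<^sub>m A) = z \<cdot>\<^sub>m cj C A"
  by (simp add: cj_def sq_simps[of _ n])

lemma cj_comp: "C \<in> sq n \<Longrightarrow> D \<in> sq n \<Longrightarrow> A \<in> sq n \<Longrightarrow> cj (C * D) A = cj C (cj D A)"
  by (simp add: cj_def adj_mult[of _ n] sq_assoc[of _ n])

lemma cj_one: "unitary_op N C \<Longrightarrow> cj C (1\<^sub>m (2 ^ N)) = 1\<^sub>m (2 ^ N)"
  by (auto simp: cj_def unitary_op_def)

lemma one_cj: "A \<in> sq n \<Longrightarrow> cj (1\<^sub>m n) A = A"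
  by (simp add: cj_def)

lemma cj_cancel:
  assumes "unitary_op N C" "A \<in> sq (2 ^ N)"
  shows "cj (mat_adjoint C) (cj C A) = A" "cj C (cj (mat_adjoint C) A) = A"
  using assms by (simp_all flip: cj_comp[of _ "2 ^ N"] add: unitary_op_def one_cj)

lemma cj_inj:
  assumes "unitary_op N C" "A \<in> sq (2 ^ N)" "B \<in> sq (2 ^ N)" "cj C A = cj C B"
  shows "A = B"
  using assms cj_cancel(1) by metis

lemma cj_smult_left: "C \<in> sq n \<Longrightarrow> A \<in> sq n \<Longrightarrow> cj (z \<cdot>\<^sub>m C) A = (z * cnj z) \<cdot>\<^sub>m cj C A"
  by (simp add: cj_def mat_adjoint_smult[of _ n] sq_simps[of _ n] mult.commute)

text \<open>Conjugation is injective and the Pauli group is finite, so mapping it into itself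
  already means mapping it onto itself.\<close>

lemma clifford_iff:
  "C \<in> clifford N \<longleftrightarrow> unitary_op N C \<and> (\<forall>\<Gamma>\<in>pauli N. cj C \<Gamma> \<in> pauli N)"
proof
  assume R: "unitary_op N C \<and> (\<forall>\<Gamma>\<in>pauli N. cj C \<Gamma> \<in> pauli N)"
  then have "inj_on (cj C) (pauli N)"
    by (auto intro!: inj_onI elim: cj_inj)
  with R have "cj C ` pauli N = pauli N"
    by (intro endo_inj_surj) auto
  with R show "C \<in> clifford N" by (simp add: clifford_def cj_def[abs_def])
qed (auto simp: clifford_def cj_def)

lemma S_z_sq [simp]: "S_z N \<in> sq (2 ^ N)"
  by simp

lemma S_z_square [simp]: "S_z N * S_z N = 1\<^sub>m (2 ^ N)"
  by (rule strings_square) simp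

lemma sq_one [simp]: "A \<in> sq n \<Longrightarrow> 1\<^sub>m n * A = A" "A \<in> sq n \<Longrightarrow> A * 1\<^sub>m n = A"
  by simp_all

lemma smult_left_cancel:
  assumes "A \<in> sq n" "B \<in> sq n" "z \<noteq> 0" "z \<cdot>\<^sub>m A = z \<cdot>\<^sub>m B"
  shows "A = (B :: complex mat)"
proof -
  have "(1 / z) \<cdot>\<^sub>m (z \<cdot>\<^sub>m A) = (1 / z) \<cdot>\<^sub>m (z \<cdot>\<^sub>m B)" using assms by simp
  then show ?thesis using \<open>z \<noteq> 0\<close> by simp
qed

text \<open>Block type is a commutation relation with \<open>S_z N\<close>. Conjugation preserves
  such relations, and a sign acquired by \<open>S_z N\<close> does not affect them.\<close>

lemma clifford_resI:
  assumes C: "unitary_op N C" and P: "\<And>\<Gamma>. \<Gamma> \<in> pauli N \<Longrightarrow> cj C \<Gamma> \<in> pauli N"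
    and S: "cj C (S_z N) = s \<cdot>\<^sub>m S_z N" "s = 1 \<or> s = - 1"
  shows "C \<in> clifford_res N"
proof -
  have key: "cj C \<Gamma> * S_z N = t \<cdot>\<^sub>m (S_z N * cj C \<Gamma>)"
    if "\<Gamma> \<in> pauli N" "\<Gamma> * S_z N = t \<cdot>\<^sub>m (S_z N * \<Gamma>)" for \<Gamma> t
  proof -
    \<comment> \<open>Conjugating the relation between \<Gamma> and \<open>S_z N\<close> produces
      the factor \<open>s\<close> on both sides; it is cancelled afterwards.\<close>
    have "s \<cdot>\<^sub>m (cj C \<Gamma> * S_z N) = cj C (\<Gamma> * S_z N)"
      using C that(1) by (simp add: cj_mult S sq_simps[of _ "2 ^ N"])
    also have "\<dots> = s \<cdot>\<^sub>m (t \<cdot>\<^sub>m (S_z N * cj C \<Gamma>))"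
      using C that by (simp add: cj_mult S sq_simps[of _ "2 ^ N"] cj_smult[of _ "2 ^ N"] mult.commute)
    finally have eq: "s \<cdot>\<^sub>m (cj C \<Gamma> * S_z N) = s \<cdot>\<^sub>m (t \<cdot>\<^sub>m (S_z N * cj C \<Gamma>))" .
    have "s \<noteq> 0" using S(2) by auto
    with C that(1) show ?thesis by (intro smult_left_cancel[OF _ _ _ eq, of "2 ^ N"]) simp_all
  qed
  have "cj C \<Gamma> \<in> pauli_BD N" if "\<Gamma> \<in> pauli_BD N" for \<Gamma>
    using that key[of \<Gamma> 1] P by (simp add: pauli_BD_iff)
  moreover have "cj C \<Gamma> \<in> pauli_ABD N" if "\<Gamma> \<in> pauli_ABD N" for \<Gamma>
    using that key[of \<Gamma> "- 1"] P by (simp add: pauli_ABD_iff)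
  ultimately show ?thesis using C P by (auto simp: clifford_res_def clifford_iff cj_def)
qed

lemma clifford_resD:
  assumes "C \<in> clifford_res N"
  shows "unitary_op N C" "\<Gamma> \<in> pauli N \<Longrightarrow> cj C \<Gamma> \<in> pauli N"
    "\<Gamma> \<in> pauli_BD N \<Longrightarrow> cj C \<Gamma> \<in> pauli_BD N" "\<Gamma> \<in> pauli_ABD N \<Longrightarrow> cj C \<Gamma> \<in> pauli_ABD N"
    "C \<in> sq (2 ^ N)"
  using assms by (auto simp: clifford_res_def clifford_iff cj_def)

lemma ex_pauli_ABD:
  assumes "N \<ge> 1"
  obtains T where "T \<in> pauli_ABD N"
proof -
  obtain M where N: "N = Suc M" using assms by (cases N) auto
  \<comment> \<open>A single \<open>sigma_x\<close> on the first mode flips exactly one occupation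
    number, hence the parity.\<close>
  let ?T = "wedge (Suc 0) M sigma_x (1\<^sub>m (2 ^ M))"
  have "?T \<in> strings N" unfolding N strings_Suc
    by (rule image_eqI[of _ _ "(sigma_x, 1\<^sub>m (2 ^ M))"]) simp_all
  moreover have "?T * S_z N = (- 1) \<cdot>\<^sub>m (S_z N * ?T)"
  proof -
    have one: "1\<^sub>m (2 ^ M) * S_z M = S_z M" "S_z M * 1\<^sub>m (2 ^ M) = S_z M"
      by (simp_all del: right_mult_one_mat left_mult_one_mat)
    have S: "S_z N = wedge (Suc 0) M sigma_z (S_z M)" by (simp add: N S_z_def)
    have "?T * S_z N = wedge (Suc 0) M ((- 1) \<cdot>\<^sub>m (sigma_z * sigma_x)) (1 \<cdot>\<^sub>m S_z M)"
      unfolding S by (subst wedge1_mult) (simp_all add: sigma_mult one)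
    also have "\<dots> = (- 1) \<cdot>\<^sub>m wedge (Suc 0) M (sigma_z * sigma_x) (S_z M)"
      by (subst wedge1_smult) simp_all
    also have "wedge (Suc 0) M (sigma_z * sigma_x) (S_z M) = S_z N * ?T"
      unfolding S by (subst wedge1_mult) (simp_all add: one)
    finally show ?thesis .
  qed
  ultimately have "?T \<in> pauli_ABD N" by (subst pauli_ABD_iff) (intro conjI strings_pauli)
  then show ?thesis by (rule that)
qed

lemma pauli_mult_cancel:
  assumes "T \<in> pauli N" "A \<in> sq (2 ^ N)" "B \<in> sq (2 ^ N)" "A * T = B * T"
  shows "A = B"
proof -
  have u: "T * mat_adjoint T = 1\<^sub>m (2 ^ N)" using pauli_unitary[OF assms(1)] by (simp add: unitary_op_def)
  have "X * T * mat_adjoint T = X" if "X \<in> sq (2 ^ N)" for X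
    using that assms(1) by (simp add: sq_assoc[of _ "2 ^ N"] u)
  then show ?thesis using assms by metis
qed

lemma mult_swap:
  assumes "A \<in> sq n" "B \<in> sq n" "C \<in> sq n" "A * B = z \<cdot>\<^sub>m (B * A)"
  shows "A * (B * C) = z \<cdot>\<^sub>m (B * (A * C))"
proof -
  have "A * (B * C) = (A * B) * C" using assms(1-3) by (simp add: sq_assoc[of _ n])
  also have "\<dots> = z \<cdot>\<^sub>m (B * (A * C))" unfolding assms(4) using assms by (simp add: sq_simps[of _ n])
  finally show ?thesis .
qed

text \<open>Each factor anticommutes with the parity, and the two signs cancel.\<close>

lemma pauli_BD_mult:
  assumes "A \<in> pauli_ABD N" "B \<in> pauli_ABD N"
  shows "A * B \<in> pauli_BD N"
proof -
  have s: "A \<in> pauli N" "B \<in> pauli N" "A * S_z N = (- 1) \<cdot>\<^sub>m (S_z N * A)" "B * S_z N = (- 1) \<cdot>\<^sub>m (S_z N * B)"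
    using assms by (simp_all add: pauli_ABD_iff)
  have "A * B * S_z N = S_z N * (A * B)"
    using s mult_swap[of A "2 ^ N" "S_z N" B "- 1"] by (simp add: sq_simps[of _ "2 ^ N"])
  with s show ?thesis by (simp add: pauli_BD_iff)
qed

text \<open>Multiplication by one fixed anti-block-diagonal \<open>T\<close> turns
  anti-block-diagonal operators into block-diagonal ones. So only the relation to \<open>T\<close>
  remains open: if \<Gamma> commutes with \<open>T\<close> it is scalar, and otherwise
  \<open>\<Gamma> * S_z N\<close> is.\<close>

lemma pauli_BD_centralizer:
  assumes N: "N \<ge> 1" and G: "\<Gamma> \<in> pauli N" and comm: "\<And>B. B \<in> pauli_BD N \<Longrightarrow> \<Gamma> * B = B * \<Gamma>"
  shows "\<exists>z. \<Gamma> = z \<cdot>\<^sub>m 1\<^sub>m (2 ^ N) \<or> \<Gamma> = z \<cdot>\<^sub>m S_z N"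
proof -
  obtain T where T: "T \<in> pauli_ABD N" using N by (rule ex_pauli_ABD)
  then have T': "T \<in> pauli N" and TS: "T * S_z N = (- 1) \<cdot>\<^sub>m (S_z N * T)" by (simp_all add: pauli_ABD_iff)
  \<comment> \<open>For anti-block-diagonal \<open>A\<close>, commutation with \<open>A * T\<close>
    and with \<open>T\<close> gives commutation with \<open>A\<close> after cancelling
    \<open>T\<close>; hence \<Delta> commutes with all strings.\<close>
  have scalar: "\<exists>z. \<Delta> = z \<cdot>\<^sub>m 1\<^sub>m (2 ^ N)"
    if D: "\<Delta> \<in> pauli N" and comm: "\<And>B. B \<in> pauli_BD N \<Longrightarrow> \<Delta> * B = B * \<Delta>" and DT: "\<Delta> * T = T * \<Delta>" for \<Delta>
  proof (rule pauli_commutant_scalar)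
    fix A assume "A \<in> strings N"
    then have A: "A \<in> pauli N" by simp
    from pauli_cases[OF A] show "A * \<Delta> = \<Delta> * A"
    proof
      assume "A \<in> pauli_ABD N"
      then have "\<Delta> * (A * T) = A * T * \<Delta>" using T by (intro comm pauli_BD_mult)
      then have eq: "A * \<Delta> * T = \<Delta> * A * T" using A T' D DT by (simp add: sq_assoc[of _ "2 ^ N"])
      show ?thesis by (rule pauli_mult_cancel[OF T' _ _ eq]) (use A D in simp_all)
    qed (simp add: comm)
  qed (use D in simp)
  from pauli_commute[OF G T'] show ?thesis
  proof
    assume "\<Gamma> * T = T * \<Gamma>"
    with scalar[OF G comm] show ?thesis by blast
  next
    \<comment> \<open>Both \<Gamma> and \<open>S_z N\<close> now anticommute with \<open>T\<close>,
      so their product commutes with it.\<close>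
    assume GT: "\<Gamma> * T = (- 1) \<cdot>\<^sub>m (T * \<Gamma>)"
    have GS: "\<Gamma> * S_z N = S_z N * \<Gamma>" by (rule comm) (simp add: pauli_BD_iff)
    have "\<exists>z. \<Gamma> * S_z N = z \<cdot>\<^sub>m 1\<^sub>m (2 ^ N)"
    proof (rule scalar)
      fix B assume B: "B \<in> pauli_BD N"
      then have B': "B \<in> pauli N" "B * S_z N = S_z N * B" by (simp_all add: pauli_BD_iff)
      have "\<Gamma> * S_z N * B = \<Gamma> * B * S_z N" using G B' by (simp add: sq_assoc[of _ "2 ^ N"])
      then show "\<Gamma> * S_z N * B = B * (\<Gamma> * S_z N)" using G B' comm[OF B] by (simp add: sq_assoc[of _ "2 ^ N"])
    next
      have "T * (\<Gamma> * S_z N) = T * (S_z N * \<Gamma>)" by (simp add: GS)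
      also have "\<dots> = (- 1) \<cdot>\<^sub>m (S_z N * (T * \<Gamma>))" using T' G TS by (intro mult_swap[of _ "2 ^ N"]) auto
      also have "\<dots> = S_z N * (\<Gamma> * T)" using GT T' G by (simp add: sq_simps[of _ "2 ^ N"])
      also have "\<dots> = \<Gamma> * S_z N * T" using T' G by (simp add: GS sq_simps[of _ "2 ^ N"])
      finally show "\<Gamma> * S_z N * T = T * (\<Gamma> * S_z N)" by simp
    qed (use G in simp)
    then obtain z where z: "\<Gamma> * S_z N = z \<cdot>\<^sub>m 1\<^sub>m (2 ^ N)" by blast
    have "\<Gamma> = \<Gamma> * S_z N * S_z N" using G by (simp add: sq_assoc[of _ "2 ^ N"])
    also have "\<dots> = z \<cdot>\<^sub>m S_z N" unfolding z by (simp add: sq_simps[of _ "2 ^ N"])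
    finally show ?thesis by blast
  qed
qed

lemma S_z_not_scalar:
  assumes "N \<ge> 1" shows "S_z N \<noteq> z \<cdot>\<^sub>m 1\<^sub>m (2 ^ N)"
proof
  assume eq: "S_z N = z \<cdot>\<^sub>m 1\<^sub>m (2 ^ N)"
  obtain T where T: "T \<in> pauli_ABD N" using assms by (rule ex_pauli_ABD)
  then have T': "T \<in> pauli N" "T * S_z N = (- 1) \<cdot>\<^sub>m (S_z N * T)" by (simp_all add: pauli_ABD_iff)
  have "T * S_z N = S_z N * T" using T'(1) by (simp add: eq sq_simps[of _ "2 ^ N"])
  then have "S_z N * T = (- 1) \<cdot>\<^sub>m (S_z N * T)" using T' by simp
  moreover have "S_z N * T \<in> pauli N" using T' by simp
  ultimately show False using smult_neg1_neq by blast
qed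

text \<open>Conjugation by \<open>C\<close> permutes the block-diagonal Paulis, so the image of
  \<open>S_z N\<close> still commutes with all of them and is a multiple of the identity or of
  \<open>S_z N\<close>. The first is excluded by injectivity, and squaring forces the factor to be a
  sign.\<close>

lemma clifford_res_S_z:
  assumes N: "N \<ge> 1" and C: "C \<in> clifford_res N"
  shows "\<exists>s. (s = 1 \<or> s = - 1) \<and> cj C (S_z N) = s \<cdot>\<^sub>m S_z N"
proof -
  note CD = clifford_resD[OF C]
  have "inj_on (cj C) (pauli_BD N)"
    using CD by (auto intro!: inj_onI cj_inj[of N C] simp: pauli_BD_iff)
  moreover have "finite (pauli_BD N)" by (simp add: pauli_BD_def)
  ultimately have img: "cj C ` pauli_BD N = pauli_BD N"
    using CD by (intro endo_inj_surj) auto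
  have "\<exists>z. cj C (S_z N) = z \<cdot>\<^sub>m 1\<^sub>m (2 ^ N) \<or> cj C (S_z N) = z \<cdot>\<^sub>m S_z N"
  proof (rule pauli_BD_centralizer[OF N])
    fix B assume "B \<in> pauli_BD N"
    then obtain A where A: "A \<in> pauli_BD N" "B = cj C A" using img by blast
    then show "cj C (S_z N) * B = B * cj C (S_z N)"
      using CD by (simp add: pauli_BD_iff flip: cj_mult)
  qed (use CD in simp)
  then obtain z where z: "cj C (S_z N) = z \<cdot>\<^sub>m 1\<^sub>m (2 ^ N) \<or> cj C (S_z N) = z \<cdot>\<^sub>m S_z N" by blast
  have "cj C (S_z N) \<noteq> z \<cdot>\<^sub>m 1\<^sub>m (2 ^ N)"
  proof
    assume "cj C (S_z N) = z \<cdot>\<^sub>m 1\<^sub>m (2 ^ N)"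
    then have "cj C (S_z N) = cj C (z \<cdot>\<^sub>m 1\<^sub>m (2 ^ N))"
      using CD by (simp add: cj_smult[of _ "2 ^ N"] cj_one)
    from this have "S_z N = z \<cdot>\<^sub>m 1\<^sub>m (2 ^ N)"
      by (rule cj_inj[OF CD(1), rotated 2]) simp_all
    with S_z_not_scalar[OF N] show False by blast
  qed
  with z have z: "cj C (S_z N) = z \<cdot>\<^sub>m S_z N" by blast
  have "1\<^sub>m (2 ^ N) = cj C (S_z N * S_z N)" using CD by (simp add: cj_one)
  also have "\<dots> = (z * z) \<cdot>\<^sub>m 1\<^sub>m (2 ^ N)"
    unfolding cj_mult[OF CD(1) S_z_sq S_z_sq] z by (simp add: sq_simps[of _ "2 ^ N"])
  finally have "(1\<^sub>m (2 ^ N) :: complex mat) $$ (0, 0) = ((z * z) \<cdot>\<^sub>m 1\<^sub>m (2 ^ N)) $$ (0, 0)" by simp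
  then have "z * z = 1" by simp
  with z show ?thesis by (metis square_eq_1_iff)
qed

lemma clifford_res_mult:
  assumes C: "C \<in> clifford_res N" and D: "D \<in> clifford_res N"
  shows "C * D \<in> clifford_res N"
  using clifford_resD[OF C] clifford_resD[OF D] unitary_mult[of N C D]
  by (auto simp: clifford_res_def clifford_iff cj_comp[of _ "2 ^ N"] pauli_BD_def pauli_ABD_def
      simp flip: cj_def)

text \<open>The inverse maps Paulis to Paulis because conjugation by \<open>C\<close> is onto the
  Pauli group. It acts on \<open>S_z N\<close> by the same sign, a sign being its own
  inverse.\<close>

lemma clifford_res_adj:
  assumes N: "N \<ge> 1" and C: "C \<in> clifford_res N"
  shows "mat_adjoint C \<in> clifford_res N"
proof -
  note CD = clifford_resD[OF C]
  obtain s where s: "s = 1 \<or> s = - 1" "cj C (S_z N) = s \<cdot>\<^sub>m S_z N"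
    using clifford_res_S_z[OF N C] by blast
  have "cj C ` pauli N = pauli N" using C by (simp add: clifford_res_def clifford_def cj_def[abs_def])
  then have "cj (mat_adjoint C) \<Gamma> \<in> pauli N" if "\<Gamma> \<in> pauli N" for \<Gamma>
    using that CD cj_cancel(1)[OF CD(1)] pauli_sq by (metis imageE)
  moreover have "cj (mat_adjoint C) (S_z N) = s \<cdot>\<^sub>m S_z N"
  proof -
    have "S_z N = cj (mat_adjoint C) (s \<cdot>\<^sub>m S_z N)" using CD by (simp flip: s(2) add: cj_cancel)
    also have "\<dots> = s \<cdot>\<^sub>m cj (mat_adjoint C) (S_z N)" using CD by (simp add: cj_smult[of _ "2 ^ N"])
    finally have "s \<cdot>\<^sub>m S_z N = s \<cdot>\<^sub>m (s \<cdot>\<^sub>m cj (mat_adjoint C) (S_z N))" by simp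
    then show ?thesis using s(1) by auto
  qed
  ultimately show ?thesis using s CD unitary_adj by (intro clifford_resI) auto
qed

lemma cj_pauli:
  assumes A: "A \<in> pauli N" and B: "B \<in> sq (2 ^ N)" and eq: "A * B = z \<cdot>\<^sub>m (B * A)"
  shows "cj A B = z \<cdot>\<^sub>m B"
proof -
  have "A * mat_adjoint A = 1\<^sub>m (2 ^ N)" using pauli_unitary[OF A] by (simp add: unitary_op_def)
  then show ?thesis unfolding cj_def eq using A B by (simp add: sq_simps[of _ "2 ^ N"])
qed

text \<open>Conjugation by a Pauli operator only changes signs of Paulis, in particular of
  \<open>S_z N\<close>.\<close>

lemma pauli_clifford_res:
  assumes A: "A \<in> pauli N"
  shows "A \<in> clifford_res N"
proof -
  have sign: "\<exists>s. (s = 1 \<or> s = - 1) \<and> cj A B = s \<cdot>\<^sub>m B" if "B \<in> pauli N" for B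
    using pauli_commute[OF A that] cj_pauli[OF A pauli_sq[OF that]] by (metis one_smult_mat)
  have "cj A B \<in> pauli N" if "B \<in> pauli N" for B
    using sign[OF that] that by auto
  moreover obtain s where "s = 1 \<or> s = - 1" "cj A (S_z N) = s \<cdot>\<^sub>m S_z N" using sign[of "S_z N"] by auto
  ultimately show ?thesis using pauli_unitary[OF A] by (intro clifford_resI) auto
qed

subsection \<open>Orbits of Pauli strings\<close>

lemma pauli_hermitian_square:
  assumes "A \<in> pauli N" "mat_adjoint A = A"
  shows "A * A = 1\<^sub>m (2 ^ N)"
  using pauli_unitary[OF assms(1)] assms(2) by (simp add: unitary_op_def)

text \<open>For \<open>sigma_x\<close> and \<open>sigma_z\<close> this is the Hadamard gate. If
  \<open>A\<close> and \<open>B\<close> anticommute and square to the identity, the cross terms of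
  the square of \<open>A + B\<close> cancel, which explains the factor.\<close>

definition swap_op :: "complex mat \<Rightarrow> complex mat \<Rightarrow> complex mat" where
  "swap_op A B = complex_of_real (1 / sqrt 2) \<cdot>\<^sub>m (A + B)"

lemma half: "complex_of_real (1 / sqrt 2) * complex_of_real (1 / sqrt 2) = 1 / 2"
  unfolding of_real_mult[symmetric] by (simp add: real_sqrt_mult_self)

context
  fixes N :: nat and A B :: "complex mat"
  assumes A: "A \<in> pauli N" "mat_adjoint A = A" and B: "B \<in> pauli N" "mat_adjoint B = B"
    and anti: "A * B = (- 1) \<cdot>\<^sub>m (B * A)"
begin

lemma swap_op_sq [simp]: "swap_op A B \<in> sq (2 ^ N)"
  using A B by (simp add: swap_op_def)

lemma swap_op_adj: "mat_adjoint (swap_op A B) = swap_op A B"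
  using A B by (simp add: swap_op_def mat_adjoint_smult[of _ "2 ^ N"] adj_add[of _ "2 ^ N"])

text \<open>Expanding the product and using \<open>B * A = - A * B\<close> covers every later case
  at once. For signs \<open>a\<close> and \<open>b\<close> only one summand survives: a multiple of
  \<Gamma> if they agree, of \<open>\<Gamma> * (A * B)\<close> if they differ.\<close>

lemma swap_op_conj:
  assumes G: "\<Gamma> \<in> sq (2 ^ N)" and a: "A * \<Gamma> = a \<cdot>\<^sub>m (\<Gamma> * A)" and b: "B * \<Gamma> = b \<cdot>\<^sub>m (\<Gamma> * B)"
  shows "swap_op A B * \<Gamma> * swap_op A B = ((a + b) / 2) \<cdot>\<^sub>m \<Gamma> + ((a - b) / 2) \<cdot>\<^sub>m (\<Gamma> * (A * B))"
proof -
  let ?n = "2 ^ N :: nat" and ?c = "complex_of_real (1 / sqrt 2)"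
  note s = pauli_sq[OF A(1)] pauli_sq[OF B(1)] G
  have ba: "B * A = (- 1) \<cdot>\<^sub>m (A * B)" using anti by simp
  have left: "swap_op A B * \<Gamma> = ?c \<cdot>\<^sub>m (a \<cdot>\<^sub>m (\<Gamma> * A) + b \<cdot>\<^sub>m (\<Gamma> * B))"
    unfolding swap_op_def using s
    by (simp add: sq_smult_left[of _ ?n] add_mult_distrib_mat[of _ ?n ?n] a b)
  have "(a \<cdot>\<^sub>m (\<Gamma> * A) + b \<cdot>\<^sub>m (\<Gamma> * B)) * (A + B) =
      (a \<cdot>\<^sub>m (\<Gamma> * A)) * (A + B) + (b \<cdot>\<^sub>m (\<Gamma> * B)) * (A + B)"
    using s by (intro add_mult_distrib_mat[of _ ?n ?n]) auto
  also have "(a \<cdot>\<^sub>m (\<Gamma> * A)) * (A + B) = a \<cdot>\<^sub>m (\<Gamma> * (A * A)) + a \<cdot>\<^sub>m (\<Gamma> * (A * B))"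
    using s by (subst mult_add_distrib_mat[of _ ?n ?n]) (simp_all add: sq_simps[of _ ?n])
  also have "(b \<cdot>\<^sub>m (\<Gamma> * B)) * (A + B) = b \<cdot>\<^sub>m (\<Gamma> * (B * A)) + b \<cdot>\<^sub>m (\<Gamma> * (B * B))"
    using s by (subst mult_add_distrib_mat[of _ ?n ?n]) (simp_all add: sq_simps[of _ ?n])
  finally have prod: "(a \<cdot>\<^sub>m (\<Gamma> * A) + b \<cdot>\<^sub>m (\<Gamma> * B)) * (A + B) =
      (a \<cdot>\<^sub>m \<Gamma> + a \<cdot>\<^sub>m (\<Gamma> * (A * B))) + ((- b) \<cdot>\<^sub>m (\<Gamma> * (A * B)) + b \<cdot>\<^sub>m \<Gamma>)"
    using s by (simp add: pauli_hermitian_square[OF A] pauli_hermitian_square[OF B] ba sq_smult_right[of _ ?n])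
  have "swap_op A B * \<Gamma> * swap_op A B =
      (?c * ?c) \<cdot>\<^sub>m ((a \<cdot>\<^sub>m (\<Gamma> * A) + b \<cdot>\<^sub>m (\<Gamma> * B)) * (A + B))"
    unfolding left unfolding swap_op_def using s
    by (simp only: sq_simps[of _ ?n] sq_mult add_carrier_mat smult_carrier_mat smult_smult_mat)
  also have "\<dots> = ((a + b) / 2) \<cdot>\<^sub>m \<Gamma> + ((a - b) / 2) \<cdot>\<^sub>m (\<Gamma> * (A * B))"
    unfolding prod half
    by (rule sq_eqI[of _ ?n]) (use s in \<open>auto simp: field_simps simp del: index_mult_mat(1)\<close>)
  finally show ?thesis .
qed

lemma swap_op_unitary: "unitary_op N (swap_op A B)"
proof -
  have "swap_op A B * 1\<^sub>m (2 ^ N) * swap_op A B =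
      ((1 + 1) / 2) \<cdot>\<^sub>m 1\<^sub>m (2 ^ N) + ((1 - 1) / 2) \<cdot>\<^sub>m (1\<^sub>m (2 ^ N) * (A * B))"
    by (rule swap_op_conj) (use A B in simp_all)
  also have "\<dots> = 1\<^sub>m (2 ^ N)"
    by (rule sq_eqI[of _ "2 ^ N"])
      (use pauli_sq[OF A(1)] pauli_sq[OF B(1)] in \<open>auto simp del: index_mult_mat(1)\<close>)
  finally show ?thesis by (simp add: unitary_op_def swap_op_adj)
qed

lemma cj_swap_op: "cj (swap_op A B) A = B"
proof -
  have "cj (swap_op A B) A = ((1 + - 1) / 2) \<cdot>\<^sub>m A + ((1 - - 1) / 2) \<cdot>\<^sub>m (A * (A * B))"
    unfolding cj_def swap_op_adj by (rule swap_op_conj) (use A B anti in simp_all)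
  also have "A * (A * B) = B"
    using A B pauli_hermitian_square[OF A] by (simp add: sq_assoc[of _ "2 ^ N", symmetric])
  also have "((1 + - 1) / 2) \<cdot>\<^sub>m A + ((1 - - 1) / 2) \<cdot>\<^sub>m B = B"
    by (rule sq_eqI[of _ "2 ^ N"]) (use pauli_sq[OF A(1)] pauli_sq[OF B(1)] in auto)
  finally show ?thesis .
qed

text \<open>Either surviving term of \<open>swap_op_conj\<close> is a Pauli operator up to sign, so
  the unitary is Clifford.\<close>

lemma swap_op_clifford_res:
  assumes same: "A \<in> pauli_BD N \<and> B \<in> pauli_BD N \<or> A \<in> pauli_ABD N \<and> B \<in> pauli_ABD N"
  shows "swap_op A B \<in> clifford_res N"
proof -
  have plus: "(((a + a) / 2) \<cdot>\<^sub>m \<Gamma> + ((a - a) / 2) \<cdot>\<^sub>m \<Delta>) = a \<cdot>\<^sub>m \<Gamma>"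
    if "\<Gamma> \<in> sq (2 ^ N)" "\<Delta> \<in> sq (2 ^ N)" for a \<Gamma> \<Delta>
    by (rule sq_eqI[of _ "2 ^ N"]) (use that in auto)
  have minus: "(((a + - a) / 2) \<cdot>\<^sub>m \<Gamma> + ((a - - a) / 2) \<cdot>\<^sub>m \<Delta>) = a \<cdot>\<^sub>m \<Delta>"
    if "\<Gamma> \<in> sq (2 ^ N)" "\<Delta> \<in> sq (2 ^ N)" for a \<Gamma> \<Delta>
    by (rule sq_eqI[of _ "2 ^ N"]) (use that in auto)
  have sign: "\<exists>s. (s = 1 \<or> s = - 1) \<and> C * \<Gamma> = s \<cdot>\<^sub>m (\<Gamma> * C)" if "C \<in> pauli N" "\<Gamma> \<in> pauli N" for C \<Gamma>
    using pauli_commute[OF that] by (metis one_smult_mat)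
  have "cj (swap_op A B) \<Gamma> \<in> pauli N" if G: "\<Gamma> \<in> pauli N" for \<Gamma>
  proof -
    obtain a where a: "a = 1 \<or> a = - 1" "A * \<Gamma> = a \<cdot>\<^sub>m (\<Gamma> * A)" using sign[OF A(1) G] by blast
    obtain b where b: "b = 1 \<or> b = - 1" "B * \<Gamma> = b \<cdot>\<^sub>m (\<Gamma> * B)" using sign[OF B(1) G] by blast
    note eq = swap_op_conj[OF pauli_sq[OF G] a(2) b(2), folded cj_def]
    have "b = a \<or> b = - a" using a b by auto
    then have "cj (swap_op A B) \<Gamma> = a \<cdot>\<^sub>m \<Gamma> \<or> cj (swap_op A B) \<Gamma> = a \<cdot>\<^sub>m (\<Gamma> * (A * B))"
      using eq plus[of \<Gamma> "\<Gamma> * (A * B)" a] minus[of \<Gamma> "\<Gamma> * (A * B)" a] G A B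
      by (auto simp: cj_def swap_op_adj)
    moreover have "a \<in> phases" using a by auto
    ultimately show ?thesis using G A B by auto
  qed
  moreover have "\<exists>s. (s = 1 \<or> s = - 1) \<and> cj (swap_op A B) (S_z N) = s \<cdot>\<^sub>m S_z N"
  proof -
    \<comment> \<open>Equal block type means that \<open>A\<close> and \<open>B\<close> have the
      same sign against \<open>S_z N\<close>, so \<open>S_z N\<close> is preserved up to that
      sign.\<close>
    obtain s where s: "s = 1 \<or> s = - 1" "A * S_z N = s \<cdot>\<^sub>m (S_z N * A)" "B * S_z N = s \<cdot>\<^sub>m (S_z N * B)"
      using same unfolding pauli_BD_iff pauli_ABD_iff by (metis one_smult_mat)
    have "cj (swap_op A B) (S_z N) = s \<cdot>\<^sub>m S_z N"
      unfolding cj_def swap_op_adj swap_op_conj[OF S_z_sq s(2,3)]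
      by (rule plus) (use A B in simp_all)
    with s(1) show ?thesis by blast
  qed
  ultimately show ?thesis using swap_op_unitary clifford_resI by blast
qed

end

definition res_conjugate :: "nat \<Rightarrow> complex mat \<Rightarrow> complex mat \<Rightarrow> bool" where
  "res_conjugate N A B \<longleftrightarrow> (\<exists>C\<in>clifford_res N. cj C A = B)"

lemma res_conjugate_trans:
  assumes "A \<in> sq (2 ^ N)" "res_conjugate N A B" "res_conjugate N B C"
  shows "res_conjugate N A C"
proof -
  obtain U V where "U \<in> clifford_res N" "V \<in> clifford_res N" "cj U A = B" "cj V B = C"
    using assms unfolding res_conjugate_def by blast
  then show ?thesis using assms(1) unfolding res_conjugate_def
    by (intro bexI[of _ "V * U"] clifford_res_mult) (simp_all add: cj_comp[of _ "2 ^ N"] clifford_resD)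
qed

lemma res_conjugate_anticommuting:
  assumes "A \<in> pauli N" "mat_adjoint A = A" "B \<in> pauli N" "mat_adjoint B = B"
    "A * B = (- 1) \<cdot>\<^sub>m (B * A)"
    "A \<in> pauli_BD N \<and> B \<in> pauli_BD N \<or> A \<in> pauli_ABD N \<and> B \<in> pauli_ABD N"
  shows "res_conjugate N A B"
  using swap_op_clifford_res[OF assms(1-6)] cj_swap_op[OF assms(1-5)] unfolding res_conjugate_def by blast

lemma pauli_hermitian_multiple:
  assumes "\<Gamma> \<in> pauli N"
  obtains z A where "z \<in> phases" "A \<in> strings N" "A = z \<cdot>\<^sub>m \<Gamma>"
proof -
  obtain z A where 1: "z \<in> phases" "A \<in> strings N" "\<Gamma> = z \<cdot>\<^sub>m A" using assms by (rule pauliE)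
  then have eq: "A = cnj z \<cdot>\<^sub>m \<Gamma>" using phases_unit[of z] by (simp add: mult.commute)
  show ?thesis by (rule that[OF phases_cnj[OF 1(1)] 1(2) eq])
qed

lemma S_z_adj [simp]: "mat_adjoint (S_z N) = S_z N"
  by (rule strings_adj[of _ N]) simp

text \<open>Anticommuting strings are exchanged directly. Commuting ones are joined through
  \<open>\<i> \<cdot>\<^sub>m (S_z N * A)\<close>, where the imaginary unit restores hermiticity
  because \<open>S_z N\<close> and \<open>A\<close> anticommute.\<close>

lemma res_conjugate_ABD:
  assumes A: "A \<in> strings N" "A \<in> pauli_ABD N" and B: "B \<in> strings N" "B \<in> pauli_ABD N"
  shows "res_conjugate N A B"
proof (cases "A * B = B * A")
  case False
  then show ?thesis using A B pauli_commute[of A N B]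
    by (intro res_conjugate_anticommuting) (auto simp: strings_adj)
next
  case True
  let ?S = "S_z N" and ?n = "2 ^ N :: nat"
  let ?D = "\<i> \<cdot>\<^sub>m (?S * A)" \<comment> \<open>hermitian, and anticommutes with both \<open>A\<close> and \<open>B\<close>\<close>
  have AS: "A * ?S = (- 1) \<cdot>\<^sub>m (?S * A)" and BS: "B * ?S = (- 1) \<cdot>\<^sub>m (?S * B)"
    using A B by (simp_all add: pauli_ABD_iff)
  have D: "?D \<in> pauli N" using A by simp
  have Dadj: "mat_adjoint ?D = ?D"
    using A by (simp add: mat_adjoint_smult[of _ ?n] adj_mult[of _ ?n] strings_adj AS)
  have "A * ?D = (- 1) \<cdot>\<^sub>m (?D * A)"
    using A mult_swap[of A ?n ?S A, OF _ _ _ AS] by (simp add: sq_simps[of _ ?n])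
  moreover have "?D * B = (- 1) \<cdot>\<^sub>m (B * ?D)"
    using A B mult_swap[of B ?n ?S A, OF _ _ _ BS] True by (simp add: sq_simps[of _ ?n])
  moreover have "?D \<in> pauli_ABD N"
    using D A AS mult_swap[of ?S ?n ?S A 1] by (simp add: pauli_ABD_iff sq_simps[of _ ?n])
  ultimately have "res_conjugate N A ?D" "res_conjugate N ?D B"
    using A B D Dadj by (blast intro: res_conjugate_anticommuting strings_adj strings_pauli)+
  then show ?thesis by (rule res_conjugate_trans[OF strings_sq[OF A(1)]])
qed

text \<open>Distinct strings are orthogonal, whereas a string has nonzero overlap with
  itself.\<close>

lemma strings_multiple_eq:
  assumes "X \<in> strings N" "Y \<in> strings N" "X = z \<cdot>\<^sub>m Y"
  shows "X = Y"
proof (rule ccontr)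
  assume "X \<noteq> Y"
  then have 0: "tr (X * Y) = 0" using assms strings_tr by simp
  have "X * X = z \<cdot>\<^sub>m (X * Y)"
    using assms(1,2) assms(3) sq_smult_right[of X "2 ^ N" Y z] by simp
  then have "tr (X * X) = z * tr (X * Y)" using assms(1,2) by (simp add: tr_smult[of _ "2 ^ N"])
  then show False using 0 assms(1) strings_tr[of X N X] by simp
qed

lemma anticommuting_BD:
  assumes N: "N \<ge> 1" and A: "A \<in> strings N" "A \<noteq> 1\<^sub>m (2 ^ N)" "A \<noteq> S_z N"
  obtains U where "U \<in> pauli_BD N" "A * U = (- 1) \<cdot>\<^sub>m (U * A)"
proof -
  have "\<exists>U\<in>pauli_BD N. A * U \<noteq> U * A"
  proof (rule ccontr)
    assume "\<not> ?thesis"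
    then have "\<exists>z. A = z \<cdot>\<^sub>m 1\<^sub>m (2 ^ N) \<or> A = z \<cdot>\<^sub>m S_z N"
      using A by (intro pauli_BD_centralizer[OF N]) auto
    then show False using strings_multiple_eq A by (metis S_z_string strings_one)
  qed
  then obtain U where "U \<in> pauli_BD N" "A * U \<noteq> U * A" by blast
  then show ?thesis using that pauli_commute[of A N U] A by (auto simp: pauli_BD_iff)
qed

text \<open>The intermediate string must be block-diagonal and anticommute with both
  \<open>A\<close> and \<open>B\<close>; two applications of the exchange then lead from
  \<open>A\<close> to \<open>B\<close>.\<close>

lemma res_conjugate_BD:
  assumes N: "N \<ge> 1"
    and A: "A \<in> strings N" "A \<in> pauli_BD N" "A \<noteq> 1\<^sub>m (2 ^ N)" "A \<noteq> S_z N"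
    and B: "B \<in> strings N" "B \<in> pauli_BD N" "B \<noteq> 1\<^sub>m (2 ^ N)" "B \<noteq> S_z N"
  shows "res_conjugate N A B"
proof -
  let ?n = "2 ^ N :: nat"
  have "\<exists>U\<in>pauli_BD N. A * U = (- 1) \<cdot>\<^sub>m (U * A) \<and> B * U = (- 1) \<cdot>\<^sub>m (U * B)"
  proof -
    obtain U where U: "U \<in> pauli_BD N" "A * U = (- 1) \<cdot>\<^sub>m (U * A)" using anticommuting_BD[OF N A(1,3,4)] .
    obtain V where V: "V \<in> pauli_BD N" "B * V = (- 1) \<cdot>\<^sub>m (V * B)" using anticommuting_BD[OF N B(1,3,4)] .
    have UV: "U \<in> pauli N" "V \<in> pauli N" "U * S_z N = S_z N * U" "V * S_z N = S_z N * V"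
      using U V by (simp_all add: pauli_BD_iff)
    show ?thesis
    proof (cases "B * U = U * B \<and> A * V = V * A")
      \<comment> \<open>Here \<open>U\<close> sees only \<open>A\<close> and \<open>V\<close> sees
        only \<open>B\<close>, so the product \<open>U * V\<close> anticommutes with both; in the
        other case \<open>U\<close> or \<open>V\<close> alone does.\<close>
      case True
      have "U * V * S_z N = S_z N * (U * V)"
        using UV mult_swap[of U ?n "S_z N" V 1] by (simp add: sq_simps[of _ ?n])
      then have "U * V \<in> pauli_BD N" using UV by (simp add: pauli_BD_iff)
      moreover have "A * (U * V) = (- 1) \<cdot>\<^sub>m (U * V * A)"
        using UV A True mult_swap[of A ?n U V "- 1"] U(2) by (simp add: sq_simps[of _ ?n])
      moreover have "B * (U * V) = (- 1) \<cdot>\<^sub>m (U * V * B)"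
        using UV B True mult_swap[of B ?n U V 1] V(2) by (simp add: sq_simps[of _ ?n])
      ultimately show ?thesis by blast
    next
      case False
      then show ?thesis using U V UV pauli_commute[of B N U] pauli_commute[of A N V] A(1) B(1) by auto
    qed
  qed
  then obtain U where U: "U \<in> pauli_BD N" "A * U = (- 1) \<cdot>\<^sub>m (U * A)" "B * U = (- 1) \<cdot>\<^sub>m (U * B)" by blast
  then have U': "U \<in> pauli N" "U * S_z N = S_z N * U" by (simp_all add: pauli_BD_iff)
  \<comment> \<open>\<open>U\<close> may carry a phase that spoils hermiticity; passing to its
    underlying string keeps all commutation relations.\<close>
  obtain z W where W: "z \<in> phases" "W \<in> strings N" "W = z \<cdot>\<^sub>m U"
    using pauli_hermitian_multiple[OF U'(1)] by blast
  have "W \<in> pauli_BD N" using U' W(1) unfolding W(3) by (simp add: pauli_BD_iff sq_simps[of _ ?n])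
  moreover have "A * W = (- 1) \<cdot>\<^sub>m (W * A)" "W * B = (- 1) \<cdot>\<^sub>m (B * W)"
    using U U' A B unfolding W(3) by (simp_all add: sq_simps[of _ ?n])
  ultimately have "res_conjugate N A W" "res_conjugate N W B"
    using A(1,2) B(1,2) W(2) by (blast intro: res_conjugate_anticommuting strings_adj strings_pauli)+
  then show ?thesis by (rule res_conjugate_trans[OF strings_sq[OF A(1)]])
qed

subsection \<open>Classes modulo phase\<close>

lemma clifford_res_smult:
  assumes C: "C \<in> clifford_res N" and z: "cmod z = 1"
  shows "z \<cdot>\<^sub>m C \<in> clifford_res N"
proof -
  note CD = clifford_resD[OF C]
  have zz: "z * cnj z = 1" using z by (simp add: complex_norm_square[symmetric])
  then have zz: "z * cnj z = 1" "cnj z * z = 1" by (simp_all only: mult.commute[of "cnj z" z])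
  have "unitary_op N (z \<cdot>\<^sub>m C)"
  proof -
    have "(z \<cdot>\<^sub>m C) * (cnj z \<cdot>\<^sub>m mat_adjoint C) = (z * cnj z) \<cdot>\<^sub>m (C * mat_adjoint C)"
      "(cnj z \<cdot>\<^sub>m mat_adjoint C) * (z \<cdot>\<^sub>m C) = (cnj z * z) \<cdot>\<^sub>m (mat_adjoint C * C)"
      using CD(5) by (simp_all add: sq_simps[of _ "2 ^ N"] mult.commute)
    then show ?thesis using CD(1,5) unfolding zz unitary_op_def by (simp add: mat_adjoint_smult[of _ "2 ^ N"])
  qed
  moreover have "cj (z \<cdot>\<^sub>m C) \<Gamma> = cj C \<Gamma>" if "\<Gamma> \<in> pauli N" for \<Gamma>
    using that CD zz by (simp add: cj_smult_left[of _ "2 ^ N"])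
  ultimately show ?thesis using CD
    by (auto simp: clifford_res_def clifford_iff pauli_BD_def pauli_ABD_def simp flip: cj_def)
qed

lemma phase_rel_iff: "(C, D) \<in> phase_rel N \<longleftrightarrow> C \<in> clifford_res N \<and> (\<exists>z. cmod z = 1 \<and> D = z \<cdot>\<^sub>m C)"
  unfolding phase_rel_def using clifford_res_smult by auto

lemma equiv_phase_rel: "equiv (clifford_res N) (phase_rel N)"
proof (rule equivI)
  show "phase_rel N \<subseteq> clifford_res N \<times> clifford_res N" by (auto simp: phase_rel_def)
  show "refl_on (clifford_res N) (phase_rel N)"
    by (auto simp: refl_on_def phase_rel_iff intro!: exI[of _ 1])
  show "sym (phase_rel N)"
  proof (rule symI)
    fix C D assume "(C, D) \<in> phase_rel N"
    then obtain z where "C \<in> clifford_res N" "D \<in> clifford_res N" "cmod z = 1" "D = z \<cdot>\<^sub>m C"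
      by (auto simp: phase_rel_def)
    moreover from this have "z \<noteq> 0" by auto
    ultimately have "D \<in> clifford_res N \<and> cmod (1 / z) = 1 \<and> C = (1 / z) \<cdot>\<^sub>m D"
      by (simp add: norm_divide)
    then show "(D, C) \<in> phase_rel N" unfolding phase_rel_iff by blast
  qed
  show "trans (phase_rel N)"
  proof (rule transI)
    fix C D E assume "(C, D) \<in> phase_rel N" "(D, E) \<in> phase_rel N"
    then obtain y z where "C \<in> clifford_res N" "cmod y = 1" "cmod z = 1" "E = (z * y) \<cdot>\<^sub>m C"
      by (auto simp: phase_rel_iff)
    then have "C \<in> clifford_res N \<and> cmod (z * y) = 1 \<and> E = (z * y) \<cdot>\<^sub>m C" by (simp add: norm_mult)
    then show "(C, E) \<in> phase_rel N" unfolding phase_rel_iff by blast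
  qed
qed

abbreviation (input) cls :: "nat \<Rightarrow> complex mat \<Rightarrow> complex mat set" where
  "cls N C \<equiv> phase_rel N `` {C}"

lemma rep_class:
  assumes "K \<in> clifford_res_classes N"
  shows "rep K \<in> clifford_res N" "cls N (rep K) = K"
proof -
  obtain C where C: "C \<in> clifford_res N" "K = cls N C"
    using assms by (auto simp: clifford_res_classes_def elim: quotientE)
  then have "C \<in> K" using equiv_class_self[OF equiv_phase_rel] by blast
  then have "rep K \<in> K" unfolding rep_def by (rule someI)
  then have r: "(C, rep K) \<in> phase_rel N" using C by simp
  then show "rep K \<in> clifford_res N" by (simp add: phase_rel_def)
  show "cls N (rep K) = K" using equiv_class_eq[OF equiv_phase_rel r] C by simp
qed

lemma cls_in: "C \<in> clifford_res N \<Longrightarrow> cls N C \<in> clifford_res_classes N"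
  by (simp add: clifford_res_classes_def quotientI)

lemma rep_cls:
  assumes "C \<in> clifford_res N"
  obtains z where "cmod z = 1" "rep (cls N C) = z \<cdot>\<^sub>m C"
proof -
  have "(C, rep (cls N C)) \<in> phase_rel N"
    using rep_class[OF cls_in[OF assms]] eq_equiv_class[OF _ equiv_phase_rel, of N C "rep (cls N C)"]
    by simp
  then show ?thesis using that by (auto simp: phase_rel_iff)
qed

lemma cls_smult:
  assumes "C \<in> clifford_res N" "cmod z = 1"
  shows "cls N (z \<cdot>\<^sub>m C) = cls N C"
  using assms by (intro equiv_class_eq[OF equiv_phase_rel, symmetric]) (auto simp: phase_rel_iff)

text \<open>Mutually inverse maps that respect phases descend to a bijection of classes. The chosen
  representative of an image class may differ from the image by a phase, to which \<open>f\<close>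
  is blind.\<close>

lemma sum_classes_reindex:
  fixes f :: "complex mat \<Rightarrow> 'a :: comm_monoid_add"
  assumes f: "\<And>C z. C \<in> clifford_res N \<Longrightarrow> cmod z = 1 \<Longrightarrow> f (z \<cdot>\<^sub>m C) = f C"
    and \<phi>: "\<And>C. C \<in> clifford_res N \<Longrightarrow> \<phi> C \<in> clifford_res N"
    and \<psi>: "\<And>C. C \<in> clifford_res N \<Longrightarrow> \<psi> C \<in> clifford_res N"
    and \<phi>z: "\<And>C z. C \<in> clifford_res N \<Longrightarrow> cmod z = 1 \<Longrightarrow> \<exists>y. cmod y = 1 \<and> \<phi> (z \<cdot>\<^sub>m C) = y \<cdot>\<^sub>m \<phi> C"
    and \<psi>z: "\<And>C z. C \<in> clifford_res N \<Longrightarrow> cmod z = 1 \<Longrightarrow> \<exists>y. cmod y = 1 \<and> \<psi> (z \<cdot>\<^sub>m C) = y \<cdot>\<^sub>m \<psi> C"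
    and inv: "\<And>C. C \<in> clifford_res N \<Longrightarrow> \<psi> (\<phi> C) = C" "\<And>C. C \<in> clifford_res N \<Longrightarrow> \<phi> (\<psi> C) = C"
  shows "(\<Sum>K\<in>clifford_res_classes N. f (\<phi> (rep K))) = (\<Sum>K\<in>clifford_res_classes N. f (rep K))"
proof -
  \<comment> \<open>Stated for arbitrary \<open>g\<close> and \<open>h\<close>, since it is used for
    both compositions of the two maps.\<close>
  have cancel: "cls N (h (rep (cls N (g (rep K))))) = K"
    if K: "K \<in> clifford_res_classes N" and g: "\<And>C. C \<in> clifford_res N \<Longrightarrow> g C \<in> clifford_res N"
      and hz: "\<And>C z. C \<in> clifford_res N \<Longrightarrow> cmod z = 1 \<Longrightarrow> \<exists>y. cmod y = 1 \<and> h (z \<cdot>\<^sub>m C) = y \<cdot>\<^sub>m h C"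
      and hg: "\<And>C. C \<in> clifford_res N \<Longrightarrow> h (g C) = C" for K g h
  proof -
    have gK: "g (rep K) \<in> clifford_res N" using g rep_class[OF K] by simp
    obtain z where z: "cmod z = 1" "rep (cls N (g (rep K))) = z \<cdot>\<^sub>m g (rep K)" by (rule rep_cls[OF gK])
    obtain y where y: "cmod y = 1" "h (z \<cdot>\<^sub>m g (rep K)) = y \<cdot>\<^sub>m h (g (rep K))" using hz[OF gK z(1)] by blast
    show ?thesis unfolding z(2) y(2) hg[OF rep_class(1)[OF K]]
      using rep_class[OF K] y(1) by (simp add: cls_smult)
  qed
  show ?thesis
  proof (rule sum.reindex_bij_witness[of _ "\<lambda>K. cls N (\<psi> (rep K))" "\<lambda>K. cls N (\<phi> (rep K))"])
    fix K assume K: "K \<in> clifford_res_classes N"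
    show "cls N (\<psi> (rep (cls N (\<phi> (rep K))))) = K" using K \<phi> \<psi>z inv(1) by (rule cancel)
    show "cls N (\<phi> (rep (cls N (\<psi> (rep K))))) = K" using K \<psi> \<phi>z inv(2) by (rule cancel)
    show "cls N (\<phi> (rep K)) \<in> clifford_res_classes N" "cls N (\<psi> (rep K)) \<in> clifford_res_classes N"
      using rep_class[OF K] \<phi> \<psi> by (simp_all add: cls_in)
    have \<phi>K: "\<phi> (rep K) \<in> clifford_res N" using \<phi> rep_class[OF K] by simp
    obtain z where "cmod z = 1" "rep (cls N (\<phi> (rep K))) = z \<cdot>\<^sub>m \<phi> (rep K)" by (rule rep_cls[OF \<phi>K])
    then show "f (rep (cls N (\<phi> (rep K)))) = f (\<phi> (rep K))" using f \<phi>K by simp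
  qed
qed

text \<open>A class is determined by the action of its members on the finite Pauli group: two
  unitaries acting alike differ by a scalar, necessarily a phase. Finiteness matters because
  \<open>card\<close> of an infinite set is zero.\<close>

lemma finite_classes: "finite (clifford_res_classes N)"
proof -
  \<comment> \<open>Restriction makes the action extensional, so that it lies in the finite function
    space \<open>pauli N \<rightarrow>\<^sub>E pauli N\<close>.\<close>
  let ?g = "\<lambda>K. restrict (cj (rep K)) (pauli N)"
  have "inj_on ?g (clifford_res_classes N)"
  proof (rule inj_onI)
    fix K L assume K: "K \<in> clifford_res_classes N" and L: "L \<in> clifford_res_classes N" and eq: "?g K = ?g L"
    define C D where "C = rep K" and "D = rep L"
    have CN: "C \<in> clifford_res N" and DN: "D \<in> clifford_res N"
      using rep_class[OF K] rep_class[OF L] by (simp_all add: C_def D_def)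
    note C = clifford_resD[OF CN] and D = clifford_resD[OF DN]
    \<comment> \<open>The quotient of the two representatives fixes every string under conjugation,
      hence commutes with all of them and is scalar.\<close>
    define E where E_def: "E = mat_adjoint D * C"
    have E: "unitary_op N E" unfolding E_def using C D by (intro unitary_mult unitary_adj)
    have EE: "mat_adjoint E * E = 1\<^sub>m (2 ^ N)" "E * mat_adjoint E = 1\<^sub>m (2 ^ N)"
      using E by (simp_all add: unitary_op_def)
    have "\<exists>z. E = z \<cdot>\<^sub>m 1\<^sub>m (2 ^ N)"
    proof (rule pauli_commutant_scalar)
      fix A assume A: "A \<in> strings N"
      then have "cj C A = cj D A" using fun_cong[OF eq, of A] by (simp add: C_def D_def)
      then have EA: "cj E A = A" unfolding E_def using A C D by (simp add: cj_comp[of _ "2 ^ N"] cj_cancel)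
      have "A * E = cj E A * E" by (simp only: EA)
      also have "\<dots> = E * A * (mat_adjoint E * E)"
        unfolding cj_def using A E by (intro sq_assoc[of _ "2 ^ N"]) simp_all
      also have "\<dots> = E * A" using A E EE by simp
      finally show "A * E = E * A" .
    qed (use E in simp)
    then obtain z where z: "E = z \<cdot>\<^sub>m 1\<^sub>m (2 ^ N)" by blast
    have "C = D * E" unfolding E_def using C D by (simp add: unitary_cancel)
    also have "\<dots> = z \<cdot>\<^sub>m D" unfolding z using D by (simp add: sq_simps[of _ "2 ^ N"])
    finally have CD: "C = z \<cdot>\<^sub>m D" .
    have "(z * cnj z) \<cdot>\<^sub>m 1\<^sub>m (2 ^ N) = (1\<^sub>m (2 ^ N) :: complex mat)"
      using EE(2) unfolding z by (simp add: mat_adjoint_smult[of _ "2 ^ N"] sq_simps[of _ "2 ^ N"] mult.commute)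
    then have "((z * cnj z) \<cdot>\<^sub>m 1\<^sub>m (2 ^ N)) $$ (0, 0) = (1\<^sub>m (2 ^ N) :: complex mat) $$ (0, 0)" by simp
    then have "z * cnj z = 1" by simp
    then have "(cmod z)\<^sup>2 = 1" by (metis complex_norm_square of_real_1 of_real_eq_iff)
    then have "cmod z = 1"
      using norm_ge_zero[of z] unfolding power2_eq_1_iff by linarith
    then have "cls N C = cls N D" using CD DN by (simp add: cls_smult)
    then show "K = L" using rep_class[OF K] rep_class[OF L] by (simp add: C_def D_def)
  qed
  moreover have "?g ` clifford_res_classes N \<subseteq> pauli N \<rightarrow>\<^sub>E pauli N"
    using rep_class clifford_resD(2) by auto
  ultimately show ?thesis by (metis inj_on_finite finite_PiE finite_pauli)
qed

lemma card_classes: "card (clifford_res_classes N) \<noteq> 0"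
  using finite_classes[of N] cls_in[OF pauli_clifford_res[OF strings_pauli[OF strings_one]], of N] by auto

subsection \<open>The twirl\<close>

lemma wedge_unitary:
  assumes "unitary_op N C" "unitary_op M D"
  shows "unitary_op (N + M) (wedge N M C D)"
  using assms by (auto simp: unitary_op_def wedge_adj wedge_mult wedge_one)

lemma cj_wedge:
  assumes "C \<in> sq (2 ^ N)" "D \<in> sq (2 ^ M)" "A \<in> sq (2 ^ N)" "B \<in> sq (2 ^ M)"
  shows "cj (wedge N M C D) (wedge N M A B) = wedge N M (cj C A) (cj D B)"
  using assms by (simp add: cj_def wedge_adj wedge_mult)

lemma twirl_term_cj:
  assumes "C \<in> sq (2 ^ N)"
  shows "twirl_term N X C = cj (wedge N N C C) X"
    "twirl_adj_term N X C = twirl_term N X (mat_adjoint C)"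
  using assms by (simp_all add: twirl_term_def twirl_adj_term_def cj_def wedge_adj)

lemma twirl_sq [simp]: "twirl N X \<in> sq (2 ^ (N + N))" "twirl_adj N X \<in> sq (2 ^ (N + N))"
  by (simp_all add: twirl_def twirl_adj_def)

lemma twirl_index:
  assumes "i < 2 ^ (N + N)" "j < 2 ^ (N + N)"
  shows "twirl N X $$ (i, j) = (\<Sum>K\<in>clifford_res_classes N. twirl_term N X (rep K) $$ (i, j)) /
      of_nat (card (clifford_res_classes N))"
    "twirl_adj N X $$ (i, j) = (\<Sum>K\<in>clifford_res_classes N. twirl_adj_term N X (rep K) $$ (i, j)) /
      of_nat (card (clifford_res_classes N))"
  using assms by (simp_all add: twirl_def twirl_adj_def op_sum_def)

text \<open>The adjoint twirl is the twirl summed over inverses, and taking adjoints permutes the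
  classes.\<close>

lemma twirl_eq_twirl_adj:
  assumes N: "N \<ge> 1" and X: "X \<in> sq (2 ^ (N + N))"
  shows "twirl N X = twirl_adj N X"
proof (rule sq_eqI[of _ "2 ^ (N + N)"])
  fix i j assume ij: "i < (2 :: nat) ^ (N + N)" "j < (2 :: nat) ^ (N + N)"
  have "(\<Sum>K\<in>clifford_res_classes N. twirl_term N X (mat_adjoint (rep K)) $$ (i, j)) =
      (\<Sum>K\<in>clifford_res_classes N. twirl_term N X (rep K) $$ (i, j))"
  proof (rule sum_classes_reindex[of N "\<lambda>C. twirl_term N X C $$ (i, j)" mat_adjoint mat_adjoint])
    fix C z assume C: "C \<in> clifford_res N" and z: "cmod z = 1"
    show "twirl_term N X (z \<cdot>\<^sub>m C) $$ (i, j) = twirl_term N X C $$ (i, j)"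
      using twirl_term_phase(1)[OF clifford_resD(5)[OF C] X z] by simp
    show "\<exists>y. cmod y = 1 \<and> mat_adjoint (z \<cdot>\<^sub>m C) = y \<cdot>\<^sub>m mat_adjoint C"
      using z clifford_resD(5)[OF C] by (intro exI[of _ "cnj z"]) (simp add: mat_adjoint_smult[of _ "2 ^ N"])
    \<comment> \<open>The adjoint is its own inverse, so the phase condition for the second map
      repeats that for the first.\<close>
    then show "\<exists>y. cmod y = 1 \<and> mat_adjoint (z \<cdot>\<^sub>m C) = y \<cdot>\<^sub>m mat_adjoint C" .
  qed (use clifford_res_adj[OF N] adj_adj[OF clifford_resD(5)] in auto)
  then show "twirl N X $$ (i, j) = twirl_adj N X $$ (i, j)"
    using ij by (simp add: twirl_index twirl_term_cj(2)[OF clifford_resD(5)] rep_class)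
qed simp_all

lemma twirl_fixed:
  assumes X: "X \<in> sq (2 ^ (N + N))"
    and fixed: "\<And>C. C \<in> clifford_res N \<Longrightarrow> cj (wedge N N C C) X = X"
  shows "twirl N X = X"
  by (rule sq_eqI[of _ "2 ^ (N + N)"])
    (use X in \<open>simp_all add: twirl_index twirl_term_cj(1)[OF clifford_resD(5)] rep_class fixed card_classes\<close>)

lemma cj_wedge_S_z:
  assumes "N \<ge> 1" "C \<in> clifford_res N"
  shows "cj (wedge N N C C) (wedge N N (S_z N) (S_z N)) = wedge N N (S_z N) (S_z N)"
proof -
  obtain s where "s = 1 \<or> s = - 1" "cj C (S_z N) = s \<cdot>\<^sub>m S_z N"
    using clifford_res_S_z[OF assms] by blast
  then show ?thesis using clifford_resD(5)[OF assms(2)] by (auto simp: cj_wedge wedge_smult)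
qed

lemma cj_fixed_iff:
  assumes U: "unitary_op N U" and X: "X \<in> sq (2 ^ N)"
  shows "cj U X = X \<longleftrightarrow> U * X = X * U"
proof
  assume eq: "cj U X = X"
  have "U * X = cj U X * U" unfolding cj_def using U X
    by (simp add: sq_assoc[of _ "2 ^ N"]) (simp add: unitary_op_def)
  then show "U * X = X * U" by (simp only: eq)
next
  assume eq: "U * X = X * U"
  have "cj U X = X * (U * mat_adjoint U)" unfolding cj_def eq using U X by (simp add: sq_assoc[of _ "2 ^ N"])
  then show "cj U X = X" using U X by (simp add: unitary_op_def)
qed

section \<open>The swap and its parity sectors\<close>

definition same_parity :: "nat \<Rightarrow> nat \<Rightarrow> bool" where
  "same_parity N r \<longleftrightarrow> ev N (r div 2 ^ N) = ev N (r mod 2 ^ N)"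

definition swap_index :: "nat \<Rightarrow> nat \<Rightarrow> nat" where
  "swap_index N r = r mod 2 ^ N * 2 ^ N + r div 2 ^ N"

lemma swap_index:
  assumes "r < 2 ^ (N + N)"
  shows "swap_index N r < 2 ^ (N + N)" "swap_index N r div 2 ^ N = r mod 2 ^ N"
    "swap_index N r mod 2 ^ N = r div 2 ^ N" "same_parity N (swap_index N r) = same_parity N r"
  using div_mod_less[OF assms] by (auto simp: swap_index_def wedge_index_less same_parity_def)

lemma eq_swap_index:
  assumes "c < 2 ^ (N + N)"
  shows "r = swap_index N c \<longleftrightarrow> r div 2 ^ N = c mod 2 ^ N \<and> r mod 2 ^ N = c div 2 ^ N"
  using swap_index[OF assms] by (metis div_mult_mod_eq)

lemma wedge_S_z_index:
  assumes "r < 2 ^ (N + N)" "c < 2 ^ (N + N)"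
  shows "wedge N N (S_z N) (S_z N) $$ (r, c) = (if r = c then if same_parity N r then 1 else - 1 else 0)"
proof -
  have "r = c \<longleftrightarrow> r div 2 ^ N = c div 2 ^ N \<and> r mod 2 ^ N = c mod 2 ^ N" by (metis div_mult_mod_eq)
  then show ?thesis using assms
    by (auto simp: wedge_index S_z_index div_mod_less same_parity_def)
qed

text \<open>\<open>C \<and> C\<close> commutes with the total parity, since the sign picked up by
  \<open>S_z N\<close> occurs twice. Comparing entries of the two products shows that it cannot mix
  the total parity sectors.\<close>

lemma wedge_clifford_res_parity:
  assumes N: "N \<ge> 1" and C: "C \<in> clifford_res N" and rc: "r < 2 ^ (N + N)" "c < 2 ^ (N + N)"
    and p: "same_parity N r \<noteq> same_parity N c"
  shows "wedge N N C C $$ (r, c) = 0"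
proof -
  let ?W = "wedge N N C C" and ?S = "wedge N N (S_z N) (S_z N)" and ?n = "2 ^ (N + N) :: nat"
  have "?W * ?S = ?S * ?W"
    using cj_wedge_S_z[OF N C] clifford_resD(1)[OF C]
    by (subst cj_fixed_iff[symmetric, of "N + N"]) (simp_all add: wedge_unitary)
  then have "(?W * ?S) $$ (r, c) = (?S * ?W) $$ (r, c)" by simp
  moreover have "(?W * ?S) $$ (r, c) = (if same_parity N c then 1 else - 1) * ?W $$ (r, c)"
    using rc by (simp add: sq_mult_index[of _ ?n] wedge_S_z_index if_distrib[of "(*) _"] sum.delta' sum.delta
        del: index_mult_mat(1) cong: if_cong)
  moreover have "(?S * ?W) $$ (r, c) = (if same_parity N r then 1 else - 1) * ?W $$ (r, c)"
    using rc by (simp add: sq_mult_index[of _ ?n] wedge_S_z_index if_distrib[of "\<lambda>x. x * _"] sum.delta' sum.delta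
        del: index_mult_mat(1) cong: if_cong)
  ultimately show ?thesis using p by (auto split: if_splits)
qed

text \<open>The parameter \<open>e\<close> selects a parity sector, which treats \<open>H_EE\<close>
  and \<open>H_OO\<close> together. The wedge of \<open>C\<close> with itself commutes with the swap
  and respects sectors, hence commutes with each restricted swap.\<close>

lemma cj_wedge_swap:
  assumes N: "N \<ge> 1" and C: "C \<in> clifford_res N" and H: "H \<in> sq (2 ^ (N + N))"
    and Hi: "\<And>r c. r < 2 ^ (N + N) \<Longrightarrow> c < 2 ^ (N + N) \<Longrightarrow>
      H $$ (r, c) = (if r = swap_index N c \<and> same_parity N r = e then 1 else 0)"
  shows "cj (wedge N N C C) H = H"
proof -
  let ?W = "wedge N N C C" and ?n = "2 ^ (N + N) :: nat"
  have "?W * H = H * ?W"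
  proof (rule sq_eqI[of _ ?n])
    fix r c assume rc: "r < ?n" "c < ?n"
    note sr = swap_index[OF rc(1)] and sc = swap_index[OF rc(2)]
    have sw: "r = swap_index N k \<longleftrightarrow> k = swap_index N r" if "k < ?n" for k
      using that rc eq_swap_index by metis
    have "(?W * H) $$ (r, c) = (\<Sum>k<?n. ?W $$ (r, k) * H $$ (k, c))"
      using rc H by (intro sq_mult_index) simp_all
    also have "\<dots> = (\<Sum>k<?n. if k = swap_index N c then if same_parity N c = e then ?W $$ (r, k) else 0 else 0)"
      using rc sc by (intro sum.cong) (auto simp: Hi)
    also have "\<dots> = (if same_parity N c = e then ?W $$ (r, swap_index N c) else 0)"
      using sc by simp
    finally have 1: "(?W * H) $$ (r, c) = (if same_parity N c = e then ?W $$ (r, swap_index N c) else 0)" .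
    have "(H * ?W) $$ (r, c) = (\<Sum>k<?n. H $$ (r, k) * ?W $$ (k, c))"
      using rc H by (intro sq_mult_index) simp_all
    also have "\<dots> = (\<Sum>k<?n. if k = swap_index N r then if same_parity N r = e then ?W $$ (k, c) else 0 else 0)"
      using rc by (intro sum.cong) (auto simp: Hi sw)
    also have "\<dots> = (if same_parity N r = e then ?W $$ (swap_index N r, c) else 0)"
      using sr by simp
    finally have 2: "(H * ?W) $$ (r, c) = (if same_parity N r = e then ?W $$ (swap_index N r, c) else 0)" .
    \<comment> \<open>Both wedge factors are the same matrix, so exchanging the subsystems in row
      and column together changes nothing.\<close>
    have "?W $$ (r, swap_index N c) = ?W $$ (swap_index N r, c)"
      using rc sr sc by (simp add: wedge_index mult.commute)
    moreover have "?W $$ (r, swap_index N c) = 0" if "same_parity N r \<noteq> same_parity N c"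
      using that rc sc by (intro wedge_clifford_res_parity[OF N C]) auto
    ultimately show "(?W * H) $$ (r, c) = (H * ?W) $$ (r, c)" unfolding 1 2 by auto
  qed (use H in simp_all)
  then show ?thesis using clifford_resD(1)[OF C] H
    by (subst cj_fixed_iff[of "N + N"]) (simp_all add: wedge_unitary)
qed

lemma H_index:
  assumes "r < 2 ^ (N + N)" "c < 2 ^ (N + N)"
  shows "H_EE N $$ (r, c) = (if r = swap_index N c \<and> same_parity N r = True then 1 else 0)"
    "H_OO N $$ (r, c) = (if r = swap_index N c \<and> same_parity N r = False then 1 else 0)"
  using assms by (auto simp: I_H_index eq_swap_index same_parity_def)

lemma twirl_fixed_points:
  assumes N: "N \<ge> 1"
  shows "twirl N (wedge N N (1\<^sub>m (2 ^ N)) (1\<^sub>m (2 ^ N))) = wedge N N (1\<^sub>m (2 ^ N)) (1\<^sub>m (2 ^ N))"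
    "twirl N (wedge N N (S_z N) (S_z N)) = wedge N N (S_z N) (S_z N)"
    "twirl N (H_EE N) = H_EE N" "twirl N (H_OO N) = H_OO N"
proof -
  have "cj (wedge N N C C) (wedge N N (1\<^sub>m (2 ^ N)) (1\<^sub>m (2 ^ N))) = wedge N N (1\<^sub>m (2 ^ N)) (1\<^sub>m (2 ^ N))"
    if "C \<in> clifford_res N" for C
    using clifford_resD(1,5)[OF that] by (simp add: cj_wedge cj_one)
  then show "twirl N (wedge N N (1\<^sub>m (2 ^ N)) (1\<^sub>m (2 ^ N))) = wedge N N (1\<^sub>m (2 ^ N)) (1\<^sub>m (2 ^ N))"
    by (intro twirl_fixed wedge_carrier)
  show "twirl N (wedge N N (S_z N) (S_z N)) = wedge N N (S_z N) (S_z N)"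
    by (intro twirl_fixed wedge_carrier cj_wedge_S_z N)
  show "twirl N (H_EE N) = H_EE N" "twirl N (H_OO N) = H_OO N"
    using cj_wedge_swap[OF N _ I_H_sq(3) H_index(1)] cj_wedge_swap[OF N _ I_H_sq(4) H_index(2)]
    by (auto intro!: twirl_fixed)
qed

subsection \<open>Pauli coefficients of a twirled operator\<close>

text \<open>An unnormalized coefficient: strings are hermitian, so this is a Hilbert-Schmidt inner
  product, and the norm \<open>4 ^ N\<close> reappears in \<open>pauli_expansion\<close>.\<close>

definition pcoef :: "nat \<Rightarrow> complex mat \<Rightarrow> complex mat \<Rightarrow> complex mat \<Rightarrow> complex" where
  "pcoef N X A B = tr (X * wedge N N A B)"

lemma tr_cj:
  assumes W: "unitary_op N W" and X: "X \<in> sq (2 ^ N)" and V: "V \<in> sq (2 ^ N)"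
  shows "tr (cj W X * V) = tr (X * cj (mat_adjoint W) V)"
proof -
  have "tr (cj W X * V) = tr (W * (X * (mat_adjoint W * V)))"
    using W X V by (simp add: cj_def sq_assoc[of _ "2 ^ N"])
  also have "\<dots> = tr (X * (mat_adjoint W * V) * W)"
    using W X V by (intro tr_mult_commute[of _ "2 ^ N"]) simp_all
  also have "\<dots> = tr (X * cj (mat_adjoint W) V)"
    using W X V by (simp add: cj_def sq_assoc[of _ "2 ^ N"] adj_adj[of _ "2 ^ N"])
  finally show ?thesis .
qed

lemma pcoef_twirl:
  assumes X: "X \<in> sq (2 ^ (N + N))" and A: "A \<in> sq (2 ^ N)" and B: "B \<in> sq (2 ^ N)"
  shows "pcoef N (twirl N X) A B =
    (\<Sum>K\<in>clifford_res_classes N. pcoef N X (cj (mat_adjoint (rep K)) A) (cj (mat_adjoint (rep K)) B)) /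
      of_nat (card (clifford_res_classes N))"
proof -
  let ?n = "2 ^ (N + N) :: nat" and ?V = "wedge N N A B" and ?K = "clifford_res_classes N"
  let ?c = "of_nat (card ?K) :: complex"
  have t: "tr (twirl_term N X (rep K) * ?V) = pcoef N X (cj (mat_adjoint (rep K)) A) (cj (mat_adjoint (rep K)) B)"
    and s: "twirl_term N X (rep K) \<in> sq ?n"
    if "K \<in> ?K" for K
  proof -
    note D = clifford_resD[OF rep_class(1)[OF that]]
    show "tr (twirl_term N X (rep K) * ?V) = pcoef N X (cj (mat_adjoint (rep K)) A) (cj (mat_adjoint (rep K)) B)"
      using D X A B by (simp add: twirl_term_cj(1)[OF D(5)] tr_cj[of "N + N"] wedge_unitary wedge_adj cj_wedge pcoef_def)
    show "twirl_term N X (rep K) \<in> sq ?n"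
      using D X by (simp add: twirl_term_cj(1)[OF D(5)])
  qed
  have "pcoef N (twirl N X) A B = (\<Sum>i<?n. \<Sum>j<?n. (\<Sum>K\<in>?K. twirl_term N X (rep K) $$ (i, j)) / ?c * ?V $$ (j, i))"
    unfolding pcoef_def by (subst tr_mult[of _ ?n]) (simp_all add: twirl_index)
  also have "\<dots> = (\<Sum>K\<in>?K. \<Sum>i<?n. \<Sum>j<?n. twirl_term N X (rep K) $$ (i, j) * ?V $$ (j, i)) / ?c"
    by (simp add: sum_divide_distrib sum_distrib_right sum.swap[of _ _ ?K])
  also have "\<dots> = (\<Sum>K\<in>?K. tr (twirl_term N X (rep K) * ?V)) / ?c"
    using s by (simp add: tr_mult[of _ ?n])
  finally show ?thesis by (simp add: t)
qed

lemma cj_adj_smult: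
  assumes "C \<in> sq (2 ^ N)" "cmod z = 1" "A \<in> sq (2 ^ N)"
  shows "cj (mat_adjoint (z \<cdot>\<^sub>m C)) A = cj (mat_adjoint C) A"
proof -
  have "cnj z * z = 1"
    using assms(2) mult.commute[of z "cnj z"] by (metis complex_norm_square of_real_1 power_one)
  then show ?thesis using assms by (simp add: mat_adjoint_smult[of _ "2 ^ N"] cj_smult_left[of _ "2 ^ N"])
qed

text \<open>Conjugating \<open>A\<close> and \<open>B\<close> by \<open>D\<close> first amounts to
  replacing each \<open>C\<close> in the average by \<open>mat_adjoint D * C\<close>, a translation
  that permutes the classes.\<close>

lemma pcoef_twirl_invariant:
  assumes N: "N \<ge> 1" and X: "X \<in> sq (2 ^ (N + N))" and A: "A \<in> sq (2 ^ N)" and B: "B \<in> sq (2 ^ N)"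
    and D: "D \<in> clifford_res N"
  shows "pcoef N (twirl N X) (cj D A) (cj D B) = pcoef N (twirl N X) A B"
proof -
  let ?f = "\<lambda>C. pcoef N X (cj (mat_adjoint C) A) (cj (mat_adjoint C) B)"
  have D': "mat_adjoint D \<in> clifford_res N" using clifford_res_adj[OF N D] .
  note DD = clifford_resD[OF D]
  have shift: "cj (mat_adjoint C) (cj D Y) = cj (mat_adjoint (mat_adjoint D * C)) Y"
    if "C \<in> clifford_res N" "Y \<in> sq (2 ^ N)" for C Y
    using that DD clifford_resD(5)[of C N] by (simp add: adj_mult[of _ "2 ^ N"] cj_comp[of _ "2 ^ N"] adj_adj[of _ "2 ^ N"])
  have "(\<Sum>K\<in>clifford_res_classes N. ?f (mat_adjoint D * rep K)) = (\<Sum>K\<in>clifford_res_classes N. ?f (rep K))"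
  proof (rule sum_classes_reindex[of N ?f "\<lambda>C. mat_adjoint D * C" "\<lambda>C. D * C"])
    fix C z assume C: "C \<in> clifford_res N" and z: "cmod z = 1"
    show "?f (z \<cdot>\<^sub>m C) = ?f C"
      using cj_adj_smult[OF clifford_resD(5)[OF C] z A] cj_adj_smult[OF clifford_resD(5)[OF C] z B] by simp
    show "\<exists>y. cmod y = 1 \<and> mat_adjoint D * (z \<cdot>\<^sub>m C) = y \<cdot>\<^sub>m (mat_adjoint D * C)"
      using z DD clifford_resD(5)[OF C] by (intro exI[of _ z]) (simp add: sq_simps[of _ "2 ^ N"])
    show "\<exists>y. cmod y = 1 \<and> D * (z \<cdot>\<^sub>m C) = y \<cdot>\<^sub>m (D * C)"
      using z DD clifford_resD(5)[OF C] by (intro exI[of _ z]) (simp add: sq_simps[of _ "2 ^ N"])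
  next
    fix C assume C: "C \<in> clifford_res N"
    show "mat_adjoint D * C \<in> clifford_res N" "D * C \<in> clifford_res N"
      using C D D' clifford_res_mult by blast+
    show "D * (mat_adjoint D * C) = C" "mat_adjoint D * (D * C) = C"
      using unitary_cancel[OF DD(1) clifford_resD(5)[OF C]] by simp_all
  qed
  then show ?thesis
    using X A B DD by (simp add: pcoef_twirl shift rep_class)
qed

lemma strings_adj_index:
  assumes "A \<in> strings N" "i < 2 ^ N" "j < 2 ^ N"
  shows "A $$ (j, i) = cnj (A $$ (i, j))"
  using mat_adjoint_index[of A "2 ^ N" j i] assms by (simp add: strings_adj)

text \<open>Writing the coefficient as a sum over entries of \<open>M\<close> and exchanging sums
  lets completeness act in each subsystem separately; each contributes a factor
  \<open>2 ^ N\<close>.\<close>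

lemma pauli_expansion:
  assumes M: "M \<in> sq (2 ^ (N + N))" and rc: "r < 2 ^ (N + N)" "c < 2 ^ (N + N)"
  shows "(\<Sum>A\<in>strings N. \<Sum>B\<in>strings N. pcoef N M A B * wedge N N A B $$ (r, c)) = 4 ^ N * M $$ (r, c)"
proof -
  let ?n = "2 ^ (N + N) :: nat" and ?d = "\<lambda>x :: nat. x div 2 ^ N" and ?m = "\<lambda>x :: nat. x mod 2 ^ N"
  let ?S = "strings N"
  let ?a = "\<lambda>i j A. A $$ (?d r, ?d c) * cnj (A $$ (?d i, ?d j))"
  let ?b = "\<lambda>i j B. B $$ (?m r, ?m c) * cnj (B $$ (?m i, ?m j))"
  have eq: "x = y \<longleftrightarrow> ?d x = ?d y \<and> ?m x = ?m y" for x y by (metis div_mult_mod_eq)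
  have "pcoef N M A B * wedge N N A B $$ (r, c) = (\<Sum>i<?n. \<Sum>j<?n. M $$ (i, j) * (?a i j A * ?b i j B))"
    if A: "A \<in> ?S" and B: "B \<in> ?S" for A B
  proof -
    have "wedge N N A B $$ (j, i) = cnj (A $$ (?d i, ?d j)) * cnj (B $$ (?m i, ?m j))"
      if "i < ?n" "j < ?n" for i j
      using that div_mod_less[of i N N] div_mod_less[of j N N]
      by (simp add: wedge_index strings_adj_index[OF A, of "?d i" "?d j"] strings_adj_index[OF B, of "?m i" "?m j"])
    then have "pcoef N M A B = (\<Sum>i<?n. \<Sum>j<?n. M $$ (i, j) * (cnj (A $$ (?d i, ?d j)) * cnj (B $$ (?m i, ?m j))))"
      unfolding pcoef_def using M by (simp add: tr_mult[of _ ?n])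
    then show ?thesis using rc by (simp add: wedge_index sum_distrib_right sum_distrib_left mult_ac)
  qed
  then have "(\<Sum>A\<in>?S. \<Sum>B\<in>?S. pcoef N M A B * wedge N N A B $$ (r, c)) =
      (\<Sum>A\<in>?S. \<Sum>B\<in>?S. \<Sum>i<?n. \<Sum>j<?n. M $$ (i, j) * (?a i j A * ?b i j B))"
    by (intro sum.cong refl) simp
  also have "\<dots> = (\<Sum>A\<in>?S. \<Sum>i<?n. \<Sum>j<?n. \<Sum>B\<in>?S. M $$ (i, j) * (?a i j A * ?b i j B))"
    by (intro sum.cong refl) (simp only: sum.swap[of _ _ ?S])
  also have "\<dots> = (\<Sum>i<?n. \<Sum>j<?n. \<Sum>A\<in>?S. \<Sum>B\<in>?S. M $$ (i, j) * (?a i j A * ?b i j B))"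
    by (subst sum.swap, intro sum.cong refl, subst sum.swap) simp
  also have "\<dots> = (\<Sum>i<?n. \<Sum>j<?n. M $$ (i, j) * ((\<Sum>A\<in>?S. ?a i j A) * (\<Sum>B\<in>?S. ?b i j B)))"
    by (intro sum.cong refl, subst sum_product) (simp only: sum_distrib_left)
  also have "\<dots> = (\<Sum>i<?n. \<Sum>j<?n. if j = c then if i = r then 4 ^ N * M $$ (i, j) else 0 else 0)"
  proof (intro sum.cong refl)
    fix i j assume "i \<in> {..<?n}" "j \<in> {..<?n}"
    then have ij: "i < ?n" "j < ?n" by simp_all
    note s = div_mod_less[OF ij(1)] div_mod_less[OF ij(2)] div_mod_less[OF rc(1)] div_mod_less[OF rc(2)]
    show "M $$ (i, j) * ((\<Sum>A\<in>?S. ?a i j A) * (\<Sum>B\<in>?S. ?b i j B)) =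
        (if j = c then if i = r then 4 ^ N * M $$ (i, j) else 0 else 0)"
      using s eq[of i r] eq[of j c] by (auto simp: strings_complete power_mult_distrib[symmetric])
  qed
  also have "\<dots> = 4 ^ N * M $$ (r, c)" using rc by simp
  finally show ?thesis .
qed

lemma pcoef_smult:
  assumes "A \<in> sq (2 ^ N)" "B \<in> sq (2 ^ N)" "M \<in> sq (2 ^ (N + N))"
  shows "pcoef N M (y \<cdot>\<^sub>m A) (z \<cdot>\<^sub>m B) = y * z * pcoef N M A B"
  using assms by (simp add: pcoef_def wedge_smult sq_smult_right[of _ "2 ^ (N + N)"] tr_smult[of _ "2 ^ (N + N)"])

text \<open>If every string commuted with \<open>A * B\<close>, that product would be scalar and
  \<open>A\<close> a multiple of \<open>B\<close>. A string \<open>R\<close> not commuting with it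
  has opposite signs against \<open>A\<close> and \<open>B\<close>.\<close>

lemma strings_distinguish:
  assumes A: "A \<in> strings N" and B: "B \<in> strings N" and ne: "A \<noteq> B"
  obtains R y z where "R \<in> pauli N" "cj R A = y \<cdot>\<^sub>m A" "cj R B = z \<cdot>\<^sub>m B" "y * z = - 1"
proof -
  let ?n = "2 ^ N :: nat"
  have "\<exists>R\<in>strings N. R * (A * B) \<noteq> A * B * R"
  proof (rule ccontr)
    assume "\<not> ?thesis"
    then obtain z where z: "A * B = z \<cdot>\<^sub>m 1\<^sub>m ?n"
      using pauli_commutant_scalar[of "A * B" N] A B by auto
    have "A = A * B * B" using A B by (simp add: sq_assoc[of _ ?n] strings_square[OF B])
    also have "\<dots> = z \<cdot>\<^sub>m B" unfolding z using B by (simp add: sq_simps[of _ ?n])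
    finally show False using strings_multiple_eq[OF A B] ne by blast
  qed
  then obtain R where R: "R \<in> strings N" "R * (A * B) \<noteq> A * B * R" by blast
  have sign: "\<exists>s. (s = 1 \<or> s = - 1) \<and> R * C = s \<cdot>\<^sub>m (C * R)" if "C \<in> strings N" for C
    using strings_commute[OF R(1) that] by (metis one_smult_mat)
  obtain y where y: "y = 1 \<or> y = - 1" "R * A = y \<cdot>\<^sub>m (A * R)" using sign[OF A] by blast
  obtain z where z: "z = 1 \<or> z = - 1" "R * B = z \<cdot>\<^sub>m (B * R)" using sign[OF B] by blast
  have "R * (A * B) = (y * z) \<cdot>\<^sub>m (A * B * R)"
    using A B R(1) mult_swap[of R ?n A B y, OF _ _ _ y(2)] by (simp add: sq_simps[of _ ?n] z(2))
  with R(2) have "y * z \<noteq> 1" by auto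
  with y(1) z(1) have "y * z = - 1" by auto
  moreover have "cj R A = y \<cdot>\<^sub>m A" "cj R B = z \<cdot>\<^sub>m B"
    using cj_pauli[OF strings_pauli[OF R(1)] strings_sq[OF A] y(2)]
      cj_pauli[OF strings_pauli[OF R(1)] strings_sq[OF B] z(2)] by simp_all
  ultimately show ?thesis using R(1) that by (meson strings_pauli)
qed

text \<open>Invariance under the distinguishing Pauli operator equates the coefficient with its own
  negative.\<close>

lemma pcoef_twirl_offdiag:
  assumes N: "N \<ge> 1" and X: "X \<in> sq (2 ^ (N + N))"
    and A: "A \<in> strings N" and B: "B \<in> strings N" and ne: "A \<noteq> B"
  shows "pcoef N (twirl N X) A B = 0"
proof -
  obtain R y z where R: "R \<in> pauli N" "cj R A = y \<cdot>\<^sub>m A" "cj R B = z \<cdot>\<^sub>m B" "y * z = - 1"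
    using strings_distinguish[OF A B ne] .
  have "pcoef N (twirl N X) A B = pcoef N (twirl N X) (cj R A) (cj R B)"
    using A B R(1) by (intro pcoef_twirl_invariant[OF N X, symmetric]) (simp_all add: pauli_clifford_res)
  also have "\<dots> = - pcoef N (twirl N X) A B"
    using A B R by (simp add: pcoef_smult)
  finally show ?thesis by simp
qed

lemma pcoef_twirl_conjugate:
  assumes "N \<ge> 1" "X \<in> sq (2 ^ (N + N))" "A \<in> strings N" "res_conjugate N A B"
  shows "pcoef N (twirl N X) A A = pcoef N (twirl N X) B B"
  using assms pcoef_twirl_invariant[OF assms(1,2), of A A] unfolding res_conjugate_def by force

lemma obtain_constant_value:
  assumes "\<And>x y. x \<in> S \<Longrightarrow> y \<in> S \<Longrightarrow> f x = f y"
  obtains k where "\<And>x. x \<in> S \<Longrightarrow> f x = k"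
  using assms by (metis (full_types))

text \<open>By hermiticity the full sum is a completeness relation with crossed indices, giving
  \<open>2 ^ N\<close> times the swap. At a given entry only strings of one block type contribute,
  decided by the parities of the first subsystem's row and column.\<close>

lemma sum_strings_wedge:
  assumes rc: "r < 2 ^ (N + N)" "c < 2 ^ (N + N)"
  shows "(\<Sum>A\<in>strings N. if A \<in> pauli_BD N then wedge N N A A $$ (r, c) else 0) = 2 ^ N * H_EE N $$ (r, c)"
    and "(\<Sum>A\<in>strings N. if A \<in> pauli_BD N then 0 else wedge N N A A $$ (r, c)) = 2 ^ N * H_OO N $$ (r, c)"
proof -
  let ?d = "\<lambda>x :: nat. x div 2 ^ N" and ?m = "\<lambda>x :: nat. x mod 2 ^ N"
  note s = div_mod_less[OF rc(1)] div_mod_less[OF rc(2)]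
  let ?p = "ev N (?d r) = ev N (?d c)"
  have w: "wedge N N A A $$ (r, c) = A $$ (?d r, ?d c) * cnj (A $$ (?m c, ?m r))" if "A \<in> strings N" for A
    using rc s strings_adj_index[OF that, of "?m c" "?m r"] by (simp add: wedge_index)
  then have all: "(\<Sum>A\<in>strings N. wedge N N A A $$ (r, c)) = (if ?d r = ?m c \<and> ?d c = ?m r then 2 ^ N else 0)"
    using strings_complete[of "?d r" N "?d c" "?m c" "?m r"] s by simp
  have BD: "A \<in> pauli_BD N \<or> A \<in> pauli_ABD N" if "A \<in> strings N" for A
    using that by (intro pauli_cases) simp
  have zero: "wedge N N A A $$ (r, c) = 0" if "A \<in> strings N" "A \<in> pauli_BD N \<longleftrightarrow> \<not> ?p" for A
  proof -
    have "A $$ (?d r, ?d c) = 0"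
    proof (cases ?p)
      case True
      then have "A \<in> pauli_ABD N" using that BD by blast
      then show ?thesis using True s by (simp add: pauli_ABD_def anti_block_diagonal_entries)
    next
      case False
      then have "A \<in> pauli_BD N" using that by blast
      then show ?thesis using False s by (simp add: pauli_BD_def block_diagonal_entries)
    qed
    then show ?thesis using w[OF that(1)] by simp
  qed
  have "(\<Sum>A\<in>strings N. if A \<in> pauli_BD N then wedge N N A A $$ (r, c) else 0) =
      (\<Sum>A\<in>strings N. if ?p then wedge N N A A $$ (r, c) else 0)"
    by (intro sum.cong refl) (metis zero)
  then show "(\<Sum>A\<in>strings N. if A \<in> pauli_BD N then wedge N N A A $$ (r, c) else 0) = 2 ^ N * H_EE N $$ (r, c)"
    using rc all by (cases ?p) (auto simp: I_H_index)
  have "(\<Sum>A\<in>strings N. if A \<in> pauli_BD N then 0 else wedge N N A A $$ (r, c)) =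
      (\<Sum>A\<in>strings N. if ?p then 0 else wedge N N A A $$ (r, c))"
    by (intro sum.cong refl) (metis zero)
  then show "(\<Sum>A\<in>strings N. if A \<in> pauli_BD N then 0 else wedge N N A A $$ (r, c)) = 2 ^ N * H_OO N $$ (r, c)"
    using rc all by (cases ?p) (auto simp: I_H_index)
qed

lemma twirl_in_span:
  assumes N: "N \<ge> 1" and X: "X \<in> sq (2 ^ (N + N))"
  shows "\<exists>a b c d. twirl N X = a \<cdot>\<^sub>m I_EE N + b \<cdot>\<^sub>m I_OO N + c \<cdot>\<^sub>m H_EE N + d \<cdot>\<^sub>m H_OO N"
proof -
  let ?n = "2 ^ (N + N) :: nat" and ?S = "strings N" and ?I = "1\<^sub>m (2 ^ N) :: complex mat"
  let ?m = "\<lambda>A. pcoef N (twirl N X) A A"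
  have ABD: "A \<in> pauli_ABD N" if "A \<in> ?S" "A \<notin> pauli_BD N" for A
    using that pauli_cases[of A N] by simp
  \<comment> \<open>For \<open>N = 1\<close> this set is empty and any \<open>k\<close> will
    do.\<close>
  obtain k where k: "\<And>A. A \<in> {A \<in> ?S. A \<in> pauli_BD N \<and> A \<noteq> ?I \<and> A \<noteq> S_z N} \<Longrightarrow> ?m A = k"
    by (rule obtain_constant_value[of "{A \<in> ?S. A \<in> pauli_BD N \<and> A \<noteq> ?I \<and> A \<noteq> S_z N}" ?m])
      (auto intro!: pcoef_twirl_conjugate[OF N X] res_conjugate_BD[OF N])
  obtain l where l: "\<And>A. A \<in> {A \<in> ?S. A \<notin> pauli_BD N} \<Longrightarrow> ?m A = l"
    by (rule obtain_constant_value[of "{A \<in> ?S. A \<notin> pauli_BD N}" ?m])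
      (auto intro!: pcoef_twirl_conjugate[OF N X] res_conjugate_ABD ABD)
  \<comment> \<open>Together with \<open>v\<close>, the excess of the two special coefficients over
    the common block-diagonal value, so that the remaining sum runs over complete block
    types.\<close>
  define u where "u = ?m ?I - k"
  define v where "v = ?m (S_z N) - k"
  have BD: "?I \<in> pauli_BD N" "S_z N \<in> pauli_BD N" by (simp_all add: pauli_BD_iff)
  have ne: "S_z N \<noteq> ?I" using S_z_not_scalar[OF N, of 1] by simp
  have m: "?m A = (if A \<in> pauli_BD N then k else l) + (if A = ?I then u else 0) + (if A = S_z N then v else 0)"
    if "A \<in> ?S" for A
    using that k l BD ne by (auto simp: u_def v_def)
  have "4 ^ N * twirl N X $$ (r, c) = k * (2 ^ N * H_EE N $$ (r, c)) + l * (2 ^ N * H_OO N $$ (r, c)) +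
      (u + v) * I_EE N $$ (r, c) + (u - v) * I_OO N $$ (r, c)" if rc: "r < ?n" "c < ?n" for r c
  proof -
    let ?w = "\<lambda>A. wedge N N A A $$ (r, c)"
    have "4 ^ N * twirl N X $$ (r, c) =
        (\<Sum>A\<in>?S. \<Sum>B\<in>?S. pcoef N (twirl N X) A B * wedge N N A B $$ (r, c))"
      using rc by (simp add: pauli_expansion)
    also have "\<dots> = (\<Sum>A\<in>?S. \<Sum>B\<in>?S. if B = A then ?m A * ?w A else 0)"
      by (intro sum.cong refl) (simp add: pcoef_twirl_offdiag[OF N X])
    also have "\<dots> = (\<Sum>A\<in>?S. ?m A * ?w A)" by simp
    also have "\<dots> = (\<Sum>A\<in>?S. k * (if A \<in> pauli_BD N then ?w A else 0) + l * (if A \<in> pauli_BD N then 0 else ?w A)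
        + (if A = ?I then u * ?w A else 0) + (if A = S_z N then v * ?w A else 0))"
      by (intro sum.cong refl) (simp add: m algebra_simps)
    also have "\<dots> = k * (2 ^ N * H_EE N $$ (r, c)) + l * (2 ^ N * H_OO N $$ (r, c)) +
        (u * ?w ?I + v * ?w (S_z N))"
      unfolding sum_strings_wedge[OF rc, symmetric]
      by (simp add: sum.distrib sum_distrib_left)
    \<comment> \<open>In terms of the sector projectors, the identity is \<open>I_EE + I_OO\<close>
      and the wedge of \<open>S_z\<close> with itself is \<open>I_EE - I_OO\<close>.\<close>
    also have "u * ?w ?I + v * ?w (S_z N) = (u + v) * I_EE N $$ (r, c) + (u - v) * I_OO N $$ (r, c)"
      using rc by (simp add: wedge_one wedge_S_z_index I_H_index same_parity_def)
    finally show ?thesis by (simp add: add.assoc)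
  qed
  note entries = this
  have "twirl N X = ((u + v) / 4 ^ N) \<cdot>\<^sub>m I_EE N + ((u - v) / 4 ^ N) \<cdot>\<^sub>m I_OO N +
      (k * 2 ^ N / 4 ^ N) \<cdot>\<^sub>m H_EE N + (l * 2 ^ N / 4 ^ N) \<cdot>\<^sub>m H_OO N" (is "_ = ?R")
  proof (rule sq_eqI[of _ ?n])
    fix r c assume rc: "r < ?n" "c < ?n"
    have "?R $$ (r, c) = ((u + v) / 4 ^ N) * I_EE N $$ (r, c) + ((u - v) / 4 ^ N) * I_OO N $$ (r, c) +
        (k * 2 ^ N / 4 ^ N) * H_EE N $$ (r, c) + (l * 2 ^ N / 4 ^ N) * H_OO N $$ (r, c)"
      using rc by (simp add: carrier_matD[OF I_H_sq(1)] carrier_matD[OF I_H_sq(2)]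
          carrier_matD[OF I_H_sq(3)] carrier_matD[OF I_H_sq(4)])
    also have "\<dots> = (4 ^ N * twirl N X $$ (r, c)) / 4 ^ N"
      unfolding entries[OF rc] by (simp add: field_simps)
    finally show "twirl N X $$ (r, c) = ?R $$ (r, c)" by simp
  qed simp_all
  then show ?thesis by blast
qed

theorem theorem1:
  fixes N :: nat
  assumes "N \<ge> 1"
  shows
    "(\<forall>X \<in> carrier_mat (2 ^ (N + N)) (2 ^ (N + N)). twirl N X = twirl_adj N X) \<and>
     twirl N (wedge N N (1\<^sub>m (2 ^ N)) (1\<^sub>m (2 ^ N))) = wedge N N (1\<^sub>m (2 ^ N)) (1\<^sub>m (2 ^ N)) \<and>
     twirl N (wedge N N (S_z N) (S_z N)) = wedge N N (S_z N) (S_z N) \<and>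
     twirl N (H_EE N) = H_EE N \<and>
     twirl N (H_OO N) = H_OO N \<and>
     (\<forall>\<rho>. fermionic_state (N + N) \<rho> \<longrightarrow>
        (\<exists>a b c d :: complex. twirl N \<rho> =
           a \<cdot>\<^sub>m I_EE N + b \<cdot>\<^sub>m I_OO N + c \<cdot>\<^sub>m H_EE N + d \<cdot>\<^sub>m H_OO N))"
  using twirl_eq_twirl_adj[OF assms] twirl_fixed_points[OF assms] twirl_in_span[OF assms]
  by (auto simp: fermionic_state_def density_operator_def)

end
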